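(* Let $k\ge2$, let $\mathscr S$ be a finite collection of vectors $\mathbf s=(s_1,\dots,s_k)$ with non-negative integer entries, and let $(\beta_{\mathbf s})_{\mathbf s\in\mathscr S}$ be any real parameters. For $\mathbf W\in\mathcal W_k$ let $$T(\mathbf W)=\sum_{\mathbf s\in\mathscr S}\beta_{\mathbf s}\,t(\mathbf K_{1,\mathbf s},\mathbf W),$$ where $\mathbf K_{1,\mathbf s}$ is the $k$-colored star with $s_1+\dots+s_k$ edges, exactly $s_a$ of which have color $a$, and let $P(\mu)=\sum_{\mathbf s\in\mathscr S}\beta_{\mathbf s}\prod_{a=1}^k\mu_a^{s_a}$ for $\mu\in\Delta_k$. Let $\psi_n=\frac1{n^2}\log\sum_{\mathscr X\in\mathcal C_n^k}\exp\{n^2T(\mathbf W^{\mathscr X})\}$. Then $$\lim_{n\to\infty}\psi_n=\sup_{\mu\in\Delta_k}\Big\{P(\mu)-\tfrac12I_k(\mu)\Big\},\qquad I_k(\mu)=\sum_{a=1}^k\mu_a\log\mu_a.$$ Moreover, every maximizer of $\mathbf W\mapsto T(\mathbf W)-\frac12\mathcal I(\mathbf W)$ over $k$-colored probability graphons is (almost everywhere) a constant graphon $\mathbf W\equiv\mu^*$, where $\mu^*\in\Delta_k$ is a maximizer of $P-\frac12I_k$ over $\Delta_k$.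
   Context: Let $[k]=\{1,\dots,k\}$ and $\Delta_k=\{\mu\in[0,1]^k:\sum_a\mu_a=1\}$. A $k$-colored probability graphon is a measurable symmetric map $\mathbf W=(W_1,\dots,W_k):[0,1]^2\to\Delta_k$; $\mathcal W_k$ is the set of these. A $k$-colored graph $\mathbf H=(H,\sigma)$ is a finite simple graph $H$ with a map $\sigma:E(H)\to[k]$; its homomorphism density is $$t(\mathbf H,\mathbf W)=\int_{[0,1]^{V(H)}}\prod_{(u,v)\in E(H)}W_{\sigma((u,v))}(x_u,x_v)\prod_{v\in V(H)}dx_v .$$ In particular $t(\mathbf K_{1,\mathbf s},\mathbf W)=\int_0^1\prod_{a=1}^k d_{W_a}(x)^{s_a}dx$ with $d_{W_a}(x)=\int_0^1W_a(x,y)\,dy$. $\mathcal C_n^k$ is the set of all maps $\mathscr X$ from the edge set of the complete graph $K_n$ on $\{1,\dots,n\}$ to $[k]$. The empirical graphon $\mathbf W^{\mathscr X}\in\mathcal W_k$ has $W^{\mathscr X}_a(x,y)=\mathbf 1\{\mathscr X(\{u,v\})=a\}$ for $(x,y)\in(\frac{u-1}n,\frac un]\times(\frac{v-1}n,\frac vn]$, $u\ne v$, and $\mathbf W^{\mathscr X}=(\frac1k,\dots,\frac1k)$ on the diagonal blocks $u=v$. $\mathcal I(\mathbf W)=\int_{[0,1]^2}I_k(\mathbf W(x,y))\,dx\,dy$, with $0\log 0=0$. *)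

theory Defs
  imports "HOL-Analysis.Analysis"
begin

text \<open>
  The colors are the elements of a finite type \<open>'k\<close>, so \<open>CARD('k)\<close> plays the role of $k$,
  and points of the simplex and vectors $\mathbf s$ are indexed by \<open>'k\<close>.
\<close>

definition color_simplex :: "(real ^ 'k) set" where
  "color_simplex = {\<mu>. (\<forall>a. \<mu> $ a \<in> {0..1}) \<and> (\<Sum>a\<in>UNIV. \<mu> $ a) = 1}"

abbreviation unit_measure :: "real measure" where
  "unit_measure \<equiv> restrict_space lborel {0..1}"

text \<open>Only the values on the unit square matter; measurable means Borel measurable.\<close>

definition prob_graphons :: "(real \<times> real \<Rightarrow> real ^ 'k) set" where
  "prob_graphons = {W.
     W \<in> borel_measurable (restrict_space borel ({0..1} \<times> {0..1})) \<and>
     (\<forall>x\<in>{0..1}. \<forall>y\<in>{0..1}. W (x, y) \<in> color_simplex \<and> W (x, y) = W (y, x))}"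

record ('v, 'k) colored_graph =
  cg_verts :: "'v set"
  cg_edges :: "'v set set"
  cg_color :: "'v set \<Rightarrow> 'k"

definition is_colored_graph :: "('v, 'k) colored_graph \<Rightarrow> bool" where
  "is_colored_graph H \<longleftrightarrow> finite (cg_verts H) \<and>
     cg_edges H \<subseteq> {e. e \<subseteq> cg_verts H \<and> card e = 2}"

text \<open>
  Edges are unordered, so the factor of an edge is read off at an arbitrarily chosen
  enumeration of its two endpoints; for a symmetric \<open>W\<close> the choice is irrelevant.
\<close>

definition edge_factor ::
    "(real \<times> real \<Rightarrow> real ^ 'k) \<Rightarrow> ('v \<Rightarrow> real) \<Rightarrow> 'v set \<Rightarrow> 'k \<Rightarrow> real" where
  "edge_factor W x e a = (case (SOME (u, v). e = {u, v}) of (u, v) \<Rightarrow> W (x u, x v) $ a)"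

definition hom_density ::
    "('v, 'k) colored_graph \<Rightarrow> (real \<times> real \<Rightarrow> real ^ 'k) \<Rightarrow> real" where
  "hom_density H W =
     (LINT x | (\<Pi>\<^sub>M v\<in>cg_verts H. unit_measure).
        (\<Prod>e\<in>cg_edges H. edge_factor W x e (cg_color H e)))"

text \<open>
  In the star, \<open>None\<close> is the center and \<open>Some (a, i)\<close> with \<open>i < s $ a\<close> are the leaves
  attached by an edge of color \<open>a\<close>.
\<close>

definition colored_star :: "nat ^ 'k \<Rightarrow> (('k \<times> nat) option, 'k) colored_graph" where
  "colored_star s = \<lparr>
     cg_verts = insert None (Some ` {(a, i). i < s $ a}),
     cg_edges = (\<lambda>p. {None, Some p}) ` {(a, i). i < s $ a},
     cg_color = (\<lambda>e. THE a. \<exists>i. Some (a, i) \<in> e) \<rparr>"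

lemma is_colored_graph_star:
  fixes s :: "nat ^ 'k::finite"
  shows "is_colored_graph (colored_star s)"
proof -
  have "{(a, i). i < s $ a} = Sigma UNIV (\<lambda>a. {..<s $ a})" by auto
  then have "finite {(a, i). i < s $ a}" by simp
  then show ?thesis
    by (auto simp: is_colored_graph_def colored_star_def)
qed

lemma card_star_edges_of_color:
  "card {e \<in> cg_edges (colored_star s). cg_color (colored_star s) e = a} = s $ a"
proof -
  have "{e \<in> cg_edges (colored_star s). cg_color (colored_star s) e = a}
      = (\<lambda>i. {None, Some (a, i)}) ` {..<s $ a}"
    by (auto simp: colored_star_def)
  moreover have "inj_on (\<lambda>i. {None, Some (a, i)}) {..<s $ a}"
    by (auto simp: inj_on_def doubleton_eq_iff)
  ultimately show ?thesis by (simp add: card_image)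
qed

definition complete_edges :: "nat \<Rightarrow> nat set set" where
  "complete_edges n = {e. e \<subseteq> {1..n} \<and> card e = 2}"

definition colorings :: "nat \<Rightarrow> (nat set \<Rightarrow> 'k) set" where
  "colorings n = complete_edges n \<rightarrow>\<^sub>E UNIV"

text \<open>
  The index \<open>u\<close> with $x \in ((u-1)/n, u/n]$; the point \<open>0\<close>, which lies in none of
  these intervals, is put into the first block.
\<close>

definition block_index :: "nat \<Rightarrow> real \<Rightarrow> nat" where
  "block_index n x = max 1 (nat \<lceil>real n * x\<rceil>)"

definition empirical_graphon :: "nat \<Rightarrow> (nat set \<Rightarrow> 'k) \<Rightarrow> real \<times> real \<Rightarrow> real ^ 'k" where
  "empirical_graphon n X = (\<lambda>(x, y).
     let u = block_index n x; v = block_index n y in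
     \<chi> a. if u = v then 1 / real CARD('k) else if X {u, v} = a then 1 else 0)"

lemma block_index_eq:
  assumes "1 \<le> u" "u \<le> n" "x \<in> {(real u - 1) / n <.. real u / n}"
  shows "block_index n x = u"
proof -
  have "real u - 1 < real n * x" "real n * x \<le> real u"
    using assms by (auto simp: field_simps)
  then have "\<lceil>real n * x\<rceil> = int u" by (intro ceiling_unique) auto
  then show ?thesis using assms by (simp add: block_index_def)
qed

lemma empirical_graphon_in_prob_graphons:
  fixes X :: "nat set \<Rightarrow> 'k::finite"
  shows "empirical_graphon n X \<in> prob_graphons"
proof -
  have m: "block_index n \<in> measurable borel (count_space UNIV)"
    unfolding block_index_def by measurable
  have "empirical_graphon n X \<in> borel_measurable borel"
  proof (subst borel_prod[symmetric])
    have "(\<lambda>p. (block_index n (fst p), block_index n (snd p)))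
        \<in> borel \<Otimes>\<^sub>M borel \<rightarrow>\<^sub>M count_space UNIV \<Otimes>\<^sub>M count_space UNIV"
      using m by measurable
    then have 1: "(\<lambda>p. (block_index n (fst p), block_index n (snd p)))
        \<in> borel \<Otimes>\<^sub>M borel \<rightarrow>\<^sub>M count_space UNIV"
      by (simp add: pair_measure_countable)
    have 2: "(\<lambda>(u, v). \<chi> a. if u = v then 1 / real CARD('k) else if X {u, v} = a then 1 else 0)
        \<in> borel_measurable (count_space UNIV)" by simp
    have 3: "empirical_graphon n X =
        (\<lambda>(u, v). \<chi> a. if u = v then 1 / real CARD('k) else if X {u, v} = a then 1 else 0)
        \<circ> (\<lambda>p. (block_index n (fst p), block_index n (snd p)))"
      by (auto simp: empirical_graphon_def fun_eq_iff Let_def)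
    show "empirical_graphon n X \<in> borel_measurable (borel \<Otimes>\<^sub>M borel)"
      unfolding 3 by (rule measurable_comp[OF 1 2])
  qed
  then have "empirical_graphon n X \<in> borel_measurable (restrict_space borel ({0..1} \<times> {0..1}))"
    by (rule measurable_restrict_space1)
  moreover have "empirical_graphon n X (x, y) \<in> color_simplex" for x y
    by (cases "block_index n x = block_index n y")
      (auto simp: empirical_graphon_def Let_def color_simplex_def)
  moreover have "empirical_graphon n X (x, y) = empirical_graphon n X (y, x)" for x y
    by (auto simp: empirical_graphon_def Let_def vec_eq_iff insert_commute)
  ultimately show ?thesis
    unfolding prob_graphons_def by blast
qed

text \<open>As \<open>ln 0 = 0\<close>, the convention $0 \log 0 = 0$ holds.\<close>

definition entropy_fun :: "real ^ 'k \<Rightarrow> real" where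
  "entropy_fun \<mu> = (\<Sum>a\<in>UNIV. \<mu> $ a * ln (\<mu> $ a))"

definition graphon_entropy :: "(real \<times> real \<Rightarrow> real ^ 'k) \<Rightarrow> real" where
  "graphon_entropy W = (LINT p | (unit_measure \<Otimes>\<^sub>M unit_measure). entropy_fun (W p))"

definition star_functional ::
    "(nat ^ 'k) set \<Rightarrow> (nat ^ 'k \<Rightarrow> real) \<Rightarrow> (real \<times> real \<Rightarrow> real ^ 'k) \<Rightarrow> real" where
  "star_functional S \<beta> W = (\<Sum>s\<in>S. \<beta> s * hom_density (colored_star s) W)"

definition star_poly ::
    "(nat ^ 'k) set \<Rightarrow> (nat ^ 'k \<Rightarrow> real) \<Rightarrow> real ^ 'k \<Rightarrow> real" where
  "star_poly S \<beta> \<mu> = (\<Sum>s\<in>S. \<beta> s * (\<Prod>a\<in>UNIV. (\<mu> $ a) ^ (s $ a)))"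

definition log_partition :: "(nat ^ 'k) set \<Rightarrow> (nat ^ 'k \<Rightarrow> real) \<Rightarrow> nat \<Rightarrow> real" where
  "log_partition S \<beta> n = 1 / (real n)\<^sup>2 *
     ln (\<Sum>X\<in>colorings n. exp ((real n)\<^sup>2 * star_functional S \<beta> (empirical_graphon n X)))"

end

theory Submission
  imports Defs "HOL-Probability.Infinite_Product_Measure" "HOL-Real_Asymp.Real_Asymp"
begin

text \<open>
  A star integrates to $T(\mathbf W) = \int_0^1 P(d_{\mathbf W}(x))\,dx$, where $d_{\mathbf W}(x)$
  is the vector of color degrees, so everything depends on $\mathbf W$ through its degrees.

  For the maximizers, Jensen's inequality for $I_k$ in each row, with a Hellinger distance as
  defect, bounds $T - \frac12 \mathcal I$ by the average of $P - \frac12 I_k$ over the degrees.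
  Equality forces $\mathbf W(x,y) = d_{\mathbf W}(x)$ almost everywhere, and the symmetry of
  $\mathbf W$ then makes it constant.

  For the limit, no large deviation principle is needed. Weight a coloring by
  $\prod_{\{u,v\}} \sqrt{p_u(c)\, p_v(c)}$, with $c$ the color of $\{u,v\}$. By AM-GM the total
  weight is at most 1, while a coloring whose color frequencies at the vertices are exactly $p$
  has weight $\exp(\frac{n-1}2 \sum_u I_k(p_u))$. Hence the colorings with frequencies $p$
  contribute at most $\exp(n^2 \sup(P - \frac12 I_k) + O(n))$, and there are only
  $n^{O(n)}$ possible $p$. The lower bound is the Gibbs variational principle with independent
  edge colors of law $\mu$, together with a second moment bound for the degrees.
\<close>

section \<open>The simplex, entropy and the star polynomial\<close>

lemma color_simplexD:
  fixes \<mu> :: "real ^ 'k::finite"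
  assumes "\<mu> \<in> color_simplex"
  shows "0 \<le> \<mu> $ a" "\<mu> $ a \<le> 1" "(\<Sum>a\<in>UNIV. \<mu> $ a) = 1"
  using assms by (auto simp: color_simplex_def)

lemma color_simplexI:
  fixes \<mu> :: "real ^ 'k::finite"
  assumes "\<And>a. 0 \<le> \<mu> $ a" "(\<Sum>a\<in>UNIV. \<mu> $ a) = 1"
  shows "\<mu> \<in> color_simplex"
proof -
  have "\<mu> $ a \<le> 1" for a
    using member_le_sum[of a UNIV "\<lambda>a. \<mu> $ a"] assms by simp
  then show ?thesis using assms by (auto simp: color_simplex_def)
qed

lemma color_simplex_nonempty: "color_simplex \<noteq> ({} :: (real ^ 'k::finite) set)"
proof -
  have "(\<chi> a. 1 / real CARD('k)) \<in> (color_simplex :: (real ^ 'k) set)"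
    by (rule color_simplexI) auto
  then show ?thesis by blast
qed

lemma mult_ln_bounds:
  fixes x :: real
  assumes "0 \<le> x" "x \<le> 1"
  shows "- 1 \<le> x * ln x" "x * ln x \<le> 0"
proof -
  show "x * ln x \<le> 0"
    using assms by (cases "x = 0") (auto simp: mult_nonneg_nonpos ln_le_zero_iff)
  show "- 1 \<le> x * ln x"
  proof (cases "x = 0")
    case False
    then have "x > 0" using assms by simp
    then have "ln (1 / x) \<le> 1 / x - 1" by (intro ln_le_minus_one) simp
    then have "x * ln (1 / x) \<le> x * (1 / x - 1)"
      using \<open>x > 0\<close> by (intro mult_left_mono) auto
    then show ?thesis using \<open>x > 0\<close> by (simp add: ln_div algebra_simps)
  qed simp
qed

lemma entropy_fun_bounds:
  fixes \<mu> :: "real ^ 'k::finite"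
  assumes "\<mu> \<in> color_simplex"
  shows "- real CARD('k) \<le> entropy_fun \<mu>" "entropy_fun \<mu> \<le> 0"
proof -
  have "(\<Sum>a\<in>(UNIV :: 'k set). - 1) \<le> entropy_fun \<mu>"
    unfolding entropy_fun_def using color_simplexD[OF assms]
    by (intro sum_mono mult_ln_bounds) auto
  then show "- real CARD('k) \<le> entropy_fun \<mu>" by simp
  show "entropy_fun \<mu> \<le> 0"
    unfolding entropy_fun_def using color_simplexD[OF assms]
    by (intro sum_nonpos mult_ln_bounds) auto
qed

text \<open>On the simplex all factors lie in [0,1], so differences of products and of powers
  telescope without growth; each monomial contributes |\<beta> s| times its degree to the constant.
  This is how errors in the color frequencies become errors in P, in both bounds for the
  limit.\<close>

lemma star_poly_lipschitz:
  fixes S :: "(nat ^ 'k::finite) set"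
  obtains L where "0 \<le> L"
    "\<And>\<mu> \<nu>. \<mu> \<in> color_simplex \<Longrightarrow> \<nu> \<in> color_simplex \<Longrightarrow>
      \<bar>star_poly S \<beta> \<mu> - star_poly S \<beta> \<nu>\<bar> \<le> L * (\<Sum>a\<in>UNIV. \<bar>\<mu> $ a - \<nu> $ a\<bar>)"
proof
  define L where "L = (\<Sum>s\<in>S. \<bar>\<beta> s\<bar> * (\<Sum>a\<in>UNIV. real (s $ a)))"
  show "0 \<le> L" by (auto simp: L_def intro!: sum_nonneg mult_nonneg_nonneg)
  fix \<mu> \<nu> :: "real ^ 'k" assume *: "\<mu> \<in> color_simplex" "\<nu> \<in> color_simplex"
  define D where "D = (\<Sum>a\<in>UNIV. \<bar>\<mu> $ a - \<nu> $ a\<bar>)"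
  note D = color_simplexD[OF *(1)] color_simplexD[OF *(2)]
  have mono: "\<bar>(\<Prod>a\<in>UNIV. (\<mu> $ a) ^ (s $ a)) - (\<Prod>a\<in>UNIV. (\<nu> $ a) ^ (s $ a))\<bar>
      \<le> (\<Sum>a\<in>UNIV. real (s $ a)) * D" for s :: "nat ^ 'k"
  proof -
    have "norm ((\<Prod>a\<in>UNIV. (\<mu> $ a) ^ (s $ a)) - (\<Prod>a\<in>UNIV. (\<nu> $ a) ^ (s $ a)))
        \<le> (\<Sum>a\<in>UNIV. norm ((\<mu> $ a) ^ (s $ a) - (\<nu> $ a) ^ (s $ a)))"
      using D by (intro norm_prod_diff) (auto simp: norm_power power_le_one)
    also have "\<dots> \<le> (\<Sum>a\<in>UNIV. real (s $ a) * D)"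
    proof (rule sum_mono)
      fix a
      have "norm ((\<mu> $ a) ^ (s $ a) - (\<nu> $ a) ^ (s $ a)) \<le> real (s $ a) * norm (\<mu> $ a - \<nu> $ a)"
        using D by (intro norm_power_diff) auto
      also have "\<dots> \<le> real (s $ a) * D"
        unfolding D_def by (intro mult_left_mono) (auto intro: member_le_sum)
      finally show "norm ((\<mu> $ a) ^ (s $ a) - (\<nu> $ a) ^ (s $ a)) \<le> real (s $ a) * D" .
    qed
    finally show ?thesis by (simp add: sum_distrib_right)
  qed
  have "\<bar>star_poly S \<beta> \<mu> - star_poly S \<beta> \<nu>\<bar>
      = \<bar>\<Sum>s\<in>S. \<beta> s * ((\<Prod>a\<in>UNIV. (\<mu> $ a) ^ (s $ a)) - (\<Prod>a\<in>UNIV. (\<nu> $ a) ^ (s $ a)))\<bar>"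
    by (simp add: star_poly_def sum_subtractf right_diff_distrib)
  also have "\<dots> \<le> (\<Sum>s\<in>S. \<bar>\<beta> s\<bar> * ((\<Sum>a\<in>UNIV. real (s $ a)) * D))"
    by (rule order_trans[OF sum_abs]) (auto simp: abs_mult intro!: sum_mono mult_left_mono mono)
  also have "\<dots> = L * D" by (simp add: L_def sum_distrib_right mult.assoc)
  finally show "\<bar>star_poly S \<beta> \<mu> - star_poly S \<beta> \<nu>\<bar> \<le> L * (\<Sum>a\<in>UNIV. \<bar>\<mu> $ a - \<nu> $ a\<bar>)"
    by (simp add: D_def)
qed

lemma star_poly_bounded:
  fixes S :: "(nat ^ 'k::finite) set"
  assumes "\<mu> \<in> color_simplex"
  shows "\<bar>star_poly S \<beta> \<mu>\<bar> \<le> (\<Sum>s\<in>S. \<bar>\<beta> s\<bar>)"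
proof -
  have "\<bar>star_poly S \<beta> \<mu>\<bar> \<le> (\<Sum>s\<in>S. \<bar>\<beta> s * (\<Prod>a\<in>UNIV. (\<mu> $ a) ^ (s $ a))\<bar>)"
    unfolding star_poly_def by (rule sum_abs)
  also have "\<dots> \<le> (\<Sum>s\<in>S. \<bar>\<beta> s\<bar> * 1)"
    unfolding abs_mult abs_prod using color_simplexD[OF assms]
    by (intro sum_mono mult_left_mono prod_le_1) (auto simp: power_le_one)
  finally show ?thesis by simp
qed

text \<open>A \<open>SUP\<close> over the reals is a genuine supremum only for a set that is bounded
  above.\<close>

lemma bdd_above_free_energy:
  fixes S :: "(nat ^ 'k::finite) set"
  shows "bdd_above ((\<lambda>\<mu>. star_poly S \<beta> \<mu> - 1 / 2 * entropy_fun \<mu>) ` color_simplex)"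
proof (rule bdd_aboveI2)
  fix \<mu> :: "real ^ 'k" assume "\<mu> \<in> color_simplex"
  then show "star_poly S \<beta> \<mu> - 1 / 2 * entropy_fun \<mu> \<le> (\<Sum>s\<in>S. \<bar>\<beta> s\<bar>) + 1 / 2 * real CARD('k)"
    using star_poly_bounded[of \<mu> S \<beta>] entropy_fun_bounds[of \<mu>] by linarith
qed

text \<open>Apply ln t \<le> t - 1 at t = sqrt (d/w) in each coordinate: w ln (w/d) is at least 2w -
  2 sqrt (wd), which equals (sqrt w - sqrt d)^2 + (w - d), and the terms w - d sum to 0. The support
  hypothesis excludes coordinates where the relative entropy is infinite but ln 0 = 0 would hide
  it.\<close>

lemma relative_entropy_ge_hellinger:
  fixes w d :: "real ^ 'k::finite"
  assumes "w \<in> color_simplex" "d \<in> color_simplex" "\<And>a. d $ a = 0 \<Longrightarrow> w $ a = 0"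
  shows "(\<Sum>a\<in>UNIV. (sqrt (w $ a) - sqrt (d $ a))\<^sup>2)
    \<le> entropy_fun w - (\<Sum>a\<in>UNIV. w $ a * ln (d $ a))"
proof -
  note D = color_simplexD[OF assms(1)] color_simplexD[OF assms(2)]
  have "(sqrt (w $ a) - sqrt (d $ a))\<^sup>2 + (w $ a - d $ a)
      \<le> w $ a * ln (w $ a) - w $ a * ln (d $ a)" for a
  proof (cases "w $ a = 0")
    case True
    then show ?thesis using D by simp
  next
    case False
    define p q where "p = sqrt (w $ a)" and "q = sqrt (d $ a)"
    have pos: "p > 0" "q > 0"
      using False assms(3)[of a] D(1)[of a] D(4)[of a] by (auto simp: p_def q_def less_le)
    have wd: "w $ a = p\<^sup>2" "d $ a = q\<^sup>2" using D by (auto simp: p_def q_def)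
    have "ln (q / p) \<le> q / p - 1" using pos by (intro ln_le_minus_one) simp
    then have "2 * p\<^sup>2 * (ln q - ln p) \<le> 2 * p\<^sup>2 * (q / p - 1)"
      using pos by (intro mult_left_mono) (auto simp: ln_div)
    also have "\<dots> = 2 * p * q - 2 * p\<^sup>2"
      using pos by (simp add: field_simps power2_eq_square)
    finally show ?thesis
      unfolding wd using pos by (simp add: ln_realpow power2_diff algebra_simps)
  qed
  from sum_mono[of UNIV, OF this]
  have "(\<Sum>a\<in>UNIV. (sqrt (w $ a) - sqrt (d $ a))\<^sup>2 + (w $ a - d $ a))
      \<le> (\<Sum>a\<in>UNIV. w $ a * ln (w $ a) - w $ a * ln (d $ a))" .
  then show ?thesis using D
    by (simp add: entropy_fun_def sum.distrib sum_subtractf)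
qed

section \<open>Counting colorings by their degrees\<close>

lemma finite_complete_edges [simp]: "finite (complete_edges n)"
  unfolding complete_edges_def by (rule finite_subset[of _ "Pow {1..n}"]) auto

lemma card_complete_edges: "card (complete_edges n) = n choose 2"
  unfolding complete_edges_def using n_subsets[of "{1..n}" 2] by simp

lemma finite_colorings [simp]: "finite (colorings n :: (nat set \<Rightarrow> 'k::finite) set)"
  unfolding colorings_def by (intro finite_PiE) auto

lemma colorings_nonempty: "colorings n \<noteq> ({} :: (nat set \<Rightarrow> 'k) set)"
  unfolding colorings_def by (simp add: PiE_eq_empty_iff)

lemma sum_colorings_prod:
  fixes h :: "nat set \<Rightarrow> 'k::finite \<Rightarrow> real"
  shows "(\<Sum>X\<in>colorings n. \<Prod>e\<in>complete_edges n. h e (X e)) = (\<Prod>e\<in>complete_edges n. \<Sum>c\<in>UNIV. h e c)"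
  unfolding colorings_def by (rule prod_sum_PiE[symmetric]) auto

lemma pair_in_complete_edges:
  "u \<in> {1..n} \<Longrightarrow> v \<in> {1..n} - {u} \<Longrightarrow> {u, v} \<in> complete_edges n"
  by (auto simp: complete_edges_def)

text \<open>Double counting of incident pairs of a vertex and an edge; an edge at \<open>u\<close>
  is given by its other end \<open>v\<close>.\<close>

lemma prod_edges_endpoints:
  fixes g :: "nat \<Rightarrow> nat set \<Rightarrow> real"
  shows "(\<Prod>e\<in>complete_edges n. \<Prod>u\<in>e. g u e) = (\<Prod>u\<in>{1..n}. \<Prod>v\<in>{1..n} - {u}. g u {u, v})"
proof -
  have "(\<Prod>e\<in>complete_edges n. \<Prod>u\<in>e. g u e)
      = (\<Prod>e\<in>complete_edges n. \<Prod>u\<in>{u\<in>{1..n}. u \<in> e}. g u e)"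
    by (intro prod.cong refl) (auto simp: complete_edges_def)
  also have "\<dots> = (\<Prod>u\<in>{1..n}. \<Prod>e\<in>{e\<in>complete_edges n. u \<in> e}. g u e)"
    by (rule prod.swap_restrict) auto
  also have "\<dots> = (\<Prod>u\<in>{1..n}. \<Prod>v\<in>{1..n} - {u}. g u {u, v})"
  proof (intro prod.cong refl)
    fix u assume u: "u \<in> {1..n}"
    have *: "{e\<in>complete_edges n. u \<in> e} = (\<lambda>v. {u, v}) ` ({1..n} - {u})"
      using u by (auto simp: complete_edges_def card_2_iff doubleton_eq_iff)
    show "(\<Prod>e\<in>{e\<in>complete_edges n. u \<in> e}. g u e) = (\<Prod>v\<in>{1..n} - {u}. g u {u, v})"
      unfolding * by (subst prod.reindex) (auto simp: inj_on_def doubleton_eq_iff)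
  qed
  finally show ?thesis .
qed

definition color_degree :: "nat \<Rightarrow> (nat set \<Rightarrow> 'k) \<Rightarrow> nat \<Rightarrow> 'k \<Rightarrow> nat" where
  "color_degree n X u a = card {v \<in> {1..n} - {u}. X {u, v} = a}"

text \<open>Dividing by n - 1, the number of neighbors, gives the empirical law of the colors seen
  at \<open>u\<close>, a point of the simplex for n \<ge> 2.\<close>

definition color_freq :: "nat \<Rightarrow> (nat set \<Rightarrow> 'k) \<Rightarrow> nat \<Rightarrow> real ^ 'k" where
  "color_freq n X u = (\<chi> a. real (color_degree n X u a) / (real n - 1))"

lemma sum_neighbors_by_color:
  fixes h :: "'k::finite \<Rightarrow> real"
  shows "(\<Sum>v\<in>{1..n} - {u}. h (X {u, v})) = (\<Sum>a\<in>UNIV. real (color_degree n X u a) * h a)"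
proof -
  have "(\<Sum>v\<in>{1..n} - {u}. h (X {u, v}))
      = (\<Sum>a\<in>UNIV. \<Sum>v\<in>{v \<in> {1..n} - {u}. X {u, v} = a}. h (X {u, v}))"
    by (rule sum.group[symmetric]) auto
  also have "\<dots> = (\<Sum>a\<in>UNIV. real (color_degree n X u a) * h a)"
    by (intro sum.cong refl) (simp add: color_degree_def)
  finally show ?thesis .
qed

lemma sum_color_degree:
  fixes X :: "nat set \<Rightarrow> 'k::finite"
  assumes "u \<in> {1..n}"
  shows "(\<Sum>a\<in>UNIV. real (color_degree n X u a)) = real n - 1"
  using sum_neighbors_by_color[of "\<lambda>_. 1" X u n] assms by auto

lemma color_freq_in_simplex:
  fixes X :: "nat set \<Rightarrow> 'k::finite"
  assumes "u \<in> {1..n}" "n \<ge> 2"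
  shows "color_freq n X u \<in> color_simplex"
  using assms sum_color_degree[OF assms(1), of X]
  by (intro color_simplexI) (auto simp: color_freq_def simp flip: sum_divide_distrib)

section \<open>Weights of colorings for a given frequency profile\<close>

text \<open>Each edge carries the geometric mean of the laws at its two ends. The product over the
  members of \<open>e\<close> avoids choosing an orientation.\<close>

definition half_edge_weight :: "nat \<Rightarrow> (nat \<Rightarrow> real ^ 'k) \<Rightarrow> (nat set \<Rightarrow> 'k) \<Rightarrow> real" where
  "half_edge_weight n p X = (\<Prod>e\<in>complete_edges n. \<Prod>u\<in>e. sqrt (p u $ X e))"

lemma half_edge_weight_nonneg:
  fixes p :: "nat \<Rightarrow> real ^ 'k::finite"
  assumes "\<And>u. u \<in> {1..n} \<Longrightarrow> p u \<in> color_simplex"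
  shows "0 \<le> half_edge_weight n p X"
  unfolding half_edge_weight_def
proof (intro prod_nonneg ballI)
  fix e u assume "e \<in> complete_edges n" "u \<in> e"
  then have "u \<in> {1..n}" by (auto simp: complete_edges_def)
  then show "0 \<le> sqrt (p u $ X e)" using color_simplexD(1)[OF assms] by simp
qed

text \<open>The sum over all colorings factorizes over the edges. The factor of {u, v} is the
  Bhattacharyya coefficient of \<open>p u\<close> and \<open>p v\<close>, at most 1 by
  AM-GM.\<close>

lemma sum_half_edge_weight_le_1:
  fixes p :: "nat \<Rightarrow> real ^ 'k::finite"
  assumes "\<And>u. u \<in> {1..n} \<Longrightarrow> p u \<in> color_simplex"
  shows "(\<Sum>X\<in>colorings n. half_edge_weight n p X) \<le> 1"
proof -
  have "(\<Sum>X\<in>colorings n. half_edge_weight n p X)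
      = (\<Prod>e\<in>complete_edges n. \<Sum>a\<in>UNIV. \<Prod>u\<in>e. sqrt (p u $ a))"
    unfolding half_edge_weight_def by (rule sum_colorings_prod)
  also have "\<dots> \<le> 1"
  proof (rule prod_le_1, intro conjI)
    fix e assume "e \<in> complete_edges n"
    then obtain u v where e: "e = {u, v}" "u \<noteq> v" "u \<in> {1..n}" "v \<in> {1..n}"
      by (auto simp: complete_edges_def card_2_iff)
    note D = color_simplexD[OF assms[OF e(3)]] color_simplexD[OF assms[OF e(4)]]
    show "0 \<le> (\<Sum>a\<in>UNIV. \<Prod>u\<in>e. sqrt (p u $ a))"
      using D e by (intro sum_nonneg prod_nonneg) auto
    have "(\<Sum>a\<in>UNIV. \<Prod>u\<in>e. sqrt (p u $ a)) = (\<Sum>a\<in>UNIV. sqrt (p u $ a * p v $ a))"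
      using e by (simp add: real_sqrt_mult)
    also have "\<dots> \<le> (\<Sum>a\<in>UNIV. (p u $ a + p v $ a) / 2)"
      using D by (intro sum_mono arith_geo_mean_sqrt) auto
    also have "\<dots> = 1" using D by (simp add: sum.distrib flip: sum_divide_distrib)
    finally show "(\<Sum>a\<in>UNIV. \<Prod>u\<in>e. sqrt (p u $ a)) \<le> 1" .
  qed
  finally show ?thesis .
qed

text \<open>Regroup the half-edges by vertex: at \<open>u\<close> the color a occurs (n - 1) p_a
  times, each time with factor sqrt p_a, so the logarithm of the row is (n - 1)/2 times the sum of
  p_a ln p_a. Agreement of \<open>p\<close> with the frequencies is asked only on {1..n}, since
  profiles are stored as restrictions.\<close>

lemma half_edge_weight_color_freq:
  fixes X :: "nat set \<Rightarrow> 'k::finite"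
  assumes n: "n \<ge> 2" and p: "\<And>u. u \<in> {1..n} \<Longrightarrow> p u = color_freq n X u"
  shows "half_edge_weight n p X
    = exp (1 / 2 * (real n - 1) * (\<Sum>u\<in>{1..n}. entropy_fun (color_freq n X u)))"
proof -
  have row: "(\<Prod>v\<in>{1..n} - {u}. sqrt (p u $ X {u, v}))
      = exp (1 / 2 * (real n - 1) * entropy_fun (color_freq n X u))" if u: "u \<in> {1..n}" for u
  proof -
    have "(\<Prod>v\<in>{1..n} - {u}. sqrt (p u $ X {u, v}))
        = (\<Prod>v\<in>{1..n} - {u}. exp (1 / 2 * ln (color_freq n X u $ X {u, v})))"
    proof (intro prod.cong refl)
      fix v assume "v \<in> {1..n} - {u}"
      \<comment> \<open>The color of {u, v} is seen at \<open>u\<close> at least once, by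
        \<open>v\<close> itself, so its frequency is positive and its logarithm is not the default
        value.\<close>
      then have "color_degree n X u (X {u, v}) > 0"
        by (auto simp: color_degree_def card_gt_0_iff)
      then have "p u $ X {u, v} > 0" using n p[OF u] by (simp add: color_freq_def)
      then have "sqrt (p u $ X {u, v}) = exp (ln (p u $ X {u, v}) / 2)"
        by (simp flip: ln_sqrt)
      then show "sqrt (p u $ X {u, v}) = exp (1 / 2 * ln (color_freq n X u $ X {u, v}))"
        by (simp add: p[OF u])
    qed
    also have "\<dots> = exp (\<Sum>v\<in>{1..n} - {u}. 1 / 2 * ln (color_freq n X u $ X {u, v}))"
      by (simp add: exp_sum)
    also have "(\<Sum>v\<in>{1..n} - {u}. 1 / 2 * ln (color_freq n X u $ X {u, v}))
        = (\<Sum>a\<in>UNIV. real (color_degree n X u a) * (1 / 2 * ln (color_freq n X u $ a)))"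
      by (rule sum_neighbors_by_color[of "\<lambda>a. 1 / 2 * ln (color_freq n X u $ a)"])
    also have "\<dots> = 1 / 2 * (real n - 1) * entropy_fun (color_freq n X u)"
    proof -
      have "real (color_degree n X u a) = (real n - 1) * (color_freq n X u $ a)" for a
        using n by (simp add: color_freq_def)
      then show ?thesis by (simp add: entropy_fun_def sum_distrib_left mult_ac)
    qed
    finally show ?thesis .
  qed
  have "half_edge_weight n p X = (\<Prod>u\<in>{1..n}. \<Prod>v\<in>{1..n} - {u}. sqrt (p u $ X {u, v}))"
    unfolding half_edge_weight_def by (rule prod_edges_endpoints)
  also have "\<dots> = (\<Prod>u\<in>{1..n}. exp (1 / 2 * (real n - 1) * entropy_fun (color_freq n X u)))"
    by (intro prod.cong refl row)
  finally show ?thesis by (simp add: exp_sum sum_distrib_left)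
qed

text \<open>A color degree is one of 0, ..., n - 1, so each vertex admits at most n^k frequency
  vectors. The restriction to {1..n} makes profiles that agree there equal, so that they lie in a
  finite function space.\<close>

lemma card_color_freq_profiles:
  fixes n :: nat
  defines "\<P> \<equiv> (\<lambda>X :: nat set \<Rightarrow> 'k::finite. restrict (color_freq n X) {1..n}) ` colorings n"
  assumes "n \<ge> 1"
  shows "card \<P> \<le> n ^ (CARD('k) * n)"
proof -
  define V where "V = (\<lambda>c. \<chi> a :: 'k. real (c a) / (real n - 1)) ` (UNIV \<rightarrow>\<^sub>E {..<n})"
  have fin: "finite V" unfolding V_def by (intro finite_imageI finite_PiE) auto
  have cardV: "card V \<le> n ^ CARD('k)"
    using card_image_le[of "UNIV \<rightarrow>\<^sub>E {..<n}" "\<lambda>c. \<chi> a :: 'k. real (c a) / (real n - 1)"]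
    by (simp add: V_def card_PiE finite_PiE)
  have "color_freq n X u \<in> V" if "u \<in> {1..n}" for u and X :: "nat set \<Rightarrow> 'k"
  proof -
    have "color_degree n X u a < n" for a
    proof -
      have "color_degree n X u a \<le> card ({1..n} - {u})"
        unfolding color_degree_def by (intro card_mono) auto
      then show ?thesis using that by auto
    qed
    then show ?thesis unfolding V_def color_freq_def by (intro image_eqI[OF refl]) auto
  qed
  then have "\<P> \<subseteq> {1..n} \<rightarrow>\<^sub>E V" by (auto simp: \<P>_def)
  then have "card \<P> \<le> card ({1..n} \<rightarrow>\<^sub>E V)" using fin by (intro card_mono finite_PiE) auto
  also have "\<dots> = card V ^ n" by (simp add: card_PiE)
  also have "\<dots> \<le> (n ^ CARD('k)) ^ n" using cardV by (rule power_mono) simp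
  finally show ?thesis by (simp add: power_mult)
qed

text \<open>
  The exponential of \<open>f X\<close> is dominated by the weight of \<open>X\<close> for its own frequencies, hence by
  the sum of its weights over all frequency profiles; each profile has total weight at most 1.
\<close>

lemma sum_exp_colorings_le:
  fixes f :: "(nat set \<Rightarrow> 'k::finite) \<Rightarrow> real"
  assumes n: "n \<ge> 2"
    and f: "\<And>X. X \<in> colorings n \<Longrightarrow>
      f X \<le> B + 1 / 2 * (real n - 1) * (\<Sum>u\<in>{1..n}. entropy_fun (color_freq n X u))"
  shows "(\<Sum>X\<in>colorings n. exp (f X)) \<le> exp B * real n ^ (CARD('k) * n)"
proof -
  define \<P> where
    "\<P> = (\<lambda>X :: nat set \<Rightarrow> 'k. restrict (color_freq n X) {1..n}) ` colorings n"
  have fin: "finite \<P>" by (simp add: \<P>_def)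
  have simplex: "p u \<in> color_simplex" if "p \<in> \<P>" "u \<in> {1..n}" for p u
    using that color_freq_in_simplex[OF that(2) n] by (auto simp: \<P>_def)
  have "(\<Sum>X\<in>colorings n. exp (f X)) \<le> (\<Sum>X\<in>colorings n. exp B * (\<Sum>p\<in>\<P>. half_edge_weight n p X))"
  proof (rule sum_mono)
    fix X :: "nat set \<Rightarrow> 'k" assume X: "X \<in> colorings n"
    let ?p = "restrict (color_freq n X) {1..n}"
    have "?p \<in> \<P>" using X by (simp add: \<P>_def)
    have "exp (f X) \<le> exp B * half_edge_weight n ?p X"
      using f[OF X] by (subst half_edge_weight_color_freq[OF n, of _ X]) (auto simp flip: exp_add)
    also have "\<dots> \<le> exp B * (\<Sum>p\<in>\<P>. half_edge_weight n p X)"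
      by (intro mult_left_mono member_le_sum half_edge_weight_nonneg \<open>?p \<in> \<P>\<close> fin)
        (use simplex in auto)
    finally show "exp (f X) \<le> exp B * (\<Sum>p\<in>\<P>. half_edge_weight n p X)" .
  qed
  also have "\<dots> = exp B * (\<Sum>p\<in>\<P>. \<Sum>X\<in>colorings n. half_edge_weight n p X)"
    by (subst sum.swap) (simp flip: sum_distrib_left)
  also have "\<dots> \<le> exp B * (\<Sum>p\<in>\<P>. 1)"
    using simplex by (intro mult_left_mono sum_mono sum_half_edge_weight_le_1) auto
  also have "\<dots> \<le> exp B * real n ^ (CARD('k) * n)"
    using card_color_freq_profiles[of n, where 'k='k] n
    by (auto simp: \<P>_def simp flip: of_nat_power intro!: mult_left_mono)
  finally show ?thesis .
qed

section \<open>The Gibbs variational principle and independent edge colors\<close>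

text \<open>Nonnegativity of the relative entropy of q with respect to the Gibbs law exp f / Z,
  obtained termwise from ln t \<le> t - 1 at t = exp f / (Z q). The right-hand sides sum to 1 - 1 =
  0.\<close>

lemma gibbs_variational_ge:
  fixes f q :: "'a \<Rightarrow> real"
  assumes fin: "finite A" and q: "\<And>x. x \<in> A \<Longrightarrow> 0 \<le> q x" "(\<Sum>x\<in>A. q x) = 1"
  shows "(\<Sum>x\<in>A. q x * f x) - (\<Sum>x\<in>A. q x * ln (q x)) \<le> ln (\<Sum>x\<in>A. exp (f x))"
proof -
  define Z where "Z = (\<Sum>x\<in>A. exp (f x))"
  have "A \<noteq> {}" using q by auto
  then have Z: "Z > 0" unfolding Z_def using fin by (intro sum_pos) auto
  have "q x * f x - q x * ln (q x) - q x * ln Z \<le> exp (f x) / Z - q x" if "x \<in> A" for x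
  proof (cases "q x = 0")
    case True
    then show ?thesis using Z by simp
  next
    case False
    then have qx: "q x > 0" using q that by (simp add: less_le)
    have "ln (exp (f x) / (Z * q x)) \<le> exp (f x) / (Z * q x) - 1"
      using qx Z by (intro ln_le_minus_one) simp
    then have "q x * ln (exp (f x) / (Z * q x)) \<le> q x * (exp (f x) / (Z * q x) - 1)"
      using qx by (intro mult_left_mono) auto
    then show ?thesis using qx Z by (simp add: ln_div ln_mult algebra_simps)
  qed
  from sum_mono[OF this]
  have "(\<Sum>x\<in>A. q x * f x) - (\<Sum>x\<in>A. q x * ln (q x)) - (\<Sum>x\<in>A. q x) * ln Z
      \<le> (\<Sum>x\<in>A. exp (f x)) / Z - (\<Sum>x\<in>A. q x)"
    by (simp add: sum_subtractf sum_distrib_right sum_divide_distrib)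
  then show ?thesis using Z q by (simp add: Z_def)
qed

text \<open>The probability of \<open>X\<close> when the edges are colored independently with law
  \<mu>. Expectations are written as finite sums against this weight.\<close>

definition iid_weight :: "nat \<Rightarrow> real ^ 'k \<Rightarrow> (nat set \<Rightarrow> 'k) \<Rightarrow> real" where
  "iid_weight n \<mu> X = (\<Prod>e\<in>complete_edges n. \<mu> $ X e)"

context
  fixes \<mu> :: "real ^ 'k::finite" and n :: nat
  assumes \<mu>: "\<mu> \<in> color_simplex"
begin

lemma iid_weight_nonneg: "0 \<le> iid_weight n \<mu> X"
  unfolding iid_weight_def using color_simplexD[OF \<mu>] by (intro prod_nonneg) auto

text \<open>Independence of the edge colors: give every edge outside \<open>F\<close> the factor 1,
  factorize over all edges, and use that \<mu> sums to 1.\<close>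

lemma iid_expectation_prod:
  assumes "F \<subseteq> complete_edges n"
  shows "(\<Sum>X\<in>colorings n. iid_weight n \<mu> X * (\<Prod>e\<in>F. g e (X e)))
    = (\<Prod>e\<in>F. \<Sum>c\<in>UNIV. \<mu> $ c * g e c)"
proof -
  have F: "(\<Prod>e\<in>F. h e) = (\<Prod>e\<in>complete_edges n. if e \<in> F then h e else 1)" for h :: "_ \<Rightarrow> real"
    using assms by (intro prod.mono_neutral_cong_left) auto
  have "(\<Sum>X\<in>colorings n. iid_weight n \<mu> X * (\<Prod>e\<in>F. g e (X e)))
      = (\<Sum>X\<in>colorings n. \<Prod>e\<in>complete_edges n. \<mu> $ X e * (if e \<in> F then g e (X e) else 1))"
    unfolding iid_weight_def F by (simp add: prod.distrib)
  also have "\<dots> = (\<Prod>e\<in>complete_edges n. \<Sum>c\<in>UNIV. \<mu> $ c * (if e \<in> F then g e c else 1))"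
    by (rule sum_colorings_prod)
  also have "\<dots> = (\<Prod>e\<in>F. \<Sum>c\<in>UNIV. \<mu> $ c * g e c)"
    unfolding F using color_simplexD[OF \<mu>] by (intro prod.cong refl) auto
  finally show ?thesis .
qed

lemma sum_iid_weight: "(\<Sum>X\<in>colorings n. iid_weight n \<mu> X) = 1"
  using iid_expectation_prod[of "{}"] by simp

lemma iid_expectation_single:
  "e \<in> complete_edges n \<Longrightarrow>
    (\<Sum>X\<in>colorings n. iid_weight n \<mu> X * g (X e)) = (\<Sum>c\<in>UNIV. \<mu> $ c * g c)"
  using iid_expectation_prod[of "{e}" "\<lambda>_. g"] by simp

text \<open>Entropy is additive over independent edges.\<close>

lemma iid_entropy:
  "(\<Sum>X\<in>colorings n. iid_weight n \<mu> X * ln (iid_weight n \<mu> X)) = real (n choose 2) * entropy_fun \<mu>"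
proof -
  have "(\<Sum>X\<in>colorings n. iid_weight n \<mu> X * ln (iid_weight n \<mu> X))
      = (\<Sum>X\<in>colorings n. \<Sum>e\<in>complete_edges n. iid_weight n \<mu> X * ln (\<mu> $ X e))"
  proof (rule sum.cong[OF refl])
    fix X :: "nat set \<Rightarrow> 'k"
    show "iid_weight n \<mu> X * ln (iid_weight n \<mu> X)
        = (\<Sum>e\<in>complete_edges n. iid_weight n \<mu> X * ln (\<mu> $ X e))"
    \<comment> \<open>The logarithm of the product splits only if all factors are positive; at
      weight 0 both sides vanish.\<close>
    proof (cases "iid_weight n \<mu> X = 0")
      case False
      then have "\<mu> $ X e \<noteq> 0" if "e \<in> complete_edges n" for e
        using that by (auto simp: iid_weight_def)
      then have "\<mu> $ X e > 0" if "e \<in> complete_edges n" for e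
        using that color_simplexD[OF \<mu>] by (simp add: less_le)
      then show ?thesis
        using ln_prod[of "complete_edges n" "\<lambda>e. \<mu> $ X e"]
        by (simp add: iid_weight_def less_imp_neq[symmetric] flip: sum_distrib_left)
    qed simp
  qed
  also have "\<dots> = (\<Sum>e\<in>complete_edges n. entropy_fun \<mu>)"
    unfolding entropy_fun_def
    by (subst sum.swap) (intro sum.cong refl iid_expectation_single[of _ "\<lambda>c. ln (\<mu> $ c)"])
  finally show ?thesis by (simp add: card_complete_edges)
qed

text \<open>The variance of a sum of independent centered variables bounded by 1: only the n - 1
  diagonal terms survive.\<close>

lemma iid_second_moment:
  assumes u: "u \<in> {1..n}"
    and g: "(\<Sum>c\<in>UNIV. \<mu> $ c * g c) = 0" "\<And>c. \<bar>g c\<bar> \<le> 1"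
  shows "(\<Sum>X\<in>colorings n. iid_weight n \<mu> X * (\<Sum>v\<in>{1..n} - {u}. g (X {u, v}))\<^sup>2) \<le> real n"
proof -
  let ?A = "{1..n} - {u}"
  have cov: "(\<Sum>X\<in>colorings n. iid_weight n \<mu> X * (g (X {u, v}) * g (X {u, w})))
      \<le> (if v = w then 1 else 0)" if vw: "v \<in> ?A" "w \<in> ?A" for v w
  proof (cases "v = w")
    case True
    have "(\<Sum>X\<in>colorings n. iid_weight n \<mu> X * (g (X {u, v}) * g (X {u, w})))
        = (\<Sum>c\<in>UNIV. \<mu> $ c * (g c * g c))"
      using True iid_expectation_single[of "{u, v}" "\<lambda>c. g c * g c"]
        pair_in_complete_edges[OF u vw(1)] by simp
    also have "\<dots> \<le> (\<Sum>c\<in>UNIV. \<mu> $ c * 1)"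
      using color_simplexD[OF \<mu>] g(2)
      by (intro sum_mono mult_left_mono) (auto simp: abs_square_le_1 simp flip: power2_eq_square)
    also have "\<dots> = 1" using color_simplexD[OF \<mu>] by simp
    finally show ?thesis using True by simp
  next
    case False
    \<comment> \<open>Distinct neighbors give distinct edges, hence independent colors, and the
      covariance factorizes into two zero means.\<close>
    then have ne: "{u, v} \<noteq> {u, w}" by (auto simp: doubleton_eq_iff)
    have "(\<Sum>X\<in>colorings n. iid_weight n \<mu> X * (g (X {u, v}) * g (X {u, w})))
        = (\<Sum>c\<in>UNIV. \<mu> $ c * g c) * (\<Sum>c\<in>UNIV. \<mu> $ c * g c)"
      using iid_expectation_prod[of "{{u, v}, {u, w}}" "\<lambda>_. g"]
        pair_in_complete_edges[OF u vw(1)] pair_in_complete_edges[OF u vw(2)] ne by simp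
    then show ?thesis using False g(1) by simp
  qed
  have "(\<Sum>X\<in>colorings n. iid_weight n \<mu> X * (\<Sum>v\<in>?A. g (X {u, v}))\<^sup>2)
      = (\<Sum>v\<in>?A. \<Sum>w\<in>?A. \<Sum>X\<in>colorings n. iid_weight n \<mu> X * (g (X {u, v}) * g (X {u, w})))"
  proof -
    have "(\<Sum>X\<in>colorings n. iid_weight n \<mu> X * (\<Sum>v\<in>?A. g (X {u, v}))\<^sup>2)
        = (\<Sum>X\<in>colorings n. \<Sum>v\<in>?A. \<Sum>w\<in>?A. iid_weight n \<mu> X * (g (X {u, v}) * g (X {u, w})))"
      unfolding power2_eq_square sum_product by (simp only: sum_distrib_left)
    also have "\<dots> = (\<Sum>v\<in>?A. \<Sum>X\<in>colorings n. \<Sum>w\<in>?A. iid_weight n \<mu> X * (g (X {u, v}) * g (X {u, w})))"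
      by (rule sum.swap)
    also have "\<dots> = (\<Sum>v\<in>?A. \<Sum>w\<in>?A. \<Sum>X\<in>colorings n. iid_weight n \<mu> X * (g (X {u, v}) * g (X {u, w})))"
      by (intro sum.cong refl sum.swap)
    finally show ?thesis .
  qed
  also have "\<dots> \<le> (\<Sum>v\<in>?A. \<Sum>w\<in>?A. if v = w then 1 else 0)"
    by (intro sum_mono cov)
  also have "\<dots> \<le> real n" using u by auto
  finally show ?thesis .
qed

text \<open>Cauchy-Schwarz, in the pointwise form |z| \<le> (z^2 / r + r) / 2; the choice r = sqrt N
  balances the two terms.\<close>

lemma iid_abs_moment:
  assumes N: "(\<Sum>X\<in>colorings n. iid_weight n \<mu> X * (Z X)\<^sup>2) \<le> N" and "N > 0"
  shows "(\<Sum>X\<in>colorings n. iid_weight n \<mu> X * \<bar>Z X\<bar>) \<le> sqrt N"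
proof -
  define r where "r = sqrt N"
  have r: "r > 0" "N = r\<^sup>2" using \<open>N > 0\<close> by (auto simp: r_def)
  have "\<bar>z\<bar> \<le> (z\<^sup>2 / r + r) / 2" for z
  proof -
    have "0 \<le> (\<bar>z\<bar> - r)\<^sup>2" by simp
    then have "2 * r * \<bar>z\<bar> \<le> z\<^sup>2 + r\<^sup>2" by (simp add: power2_diff algebra_simps)
    then show ?thesis using r by (simp add: field_simps power2_eq_square)
  qed
  then have "(\<Sum>X\<in>colorings n. iid_weight n \<mu> X * \<bar>Z X\<bar>)
      \<le> (\<Sum>X\<in>colorings n. iid_weight n \<mu> X * (((Z X)\<^sup>2 / r + r) / 2))"
    by (intro sum_mono mult_left_mono iid_weight_nonneg)
  also have "\<dots> = (\<Sum>X\<in>colorings n. iid_weight n \<mu> X * (Z X)\<^sup>2 / (2 * r) + iid_weight n \<mu> X * (r / 2))"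
    by (intro sum.cong refl) (simp add: field_simps)
  also have "\<dots> = (\<Sum>X\<in>colorings n. iid_weight n \<mu> X * (Z X)\<^sup>2) / (2 * r) + r / 2"
    by (simp add: sum.distrib sum_iid_weight flip: sum_divide_distrib sum_distrib_right)
  also have "\<dots> \<le> N / (2 * r) + r / 2" using N r by (simp add: divide_right_mono)
  also have "\<dots> = r" using r by (simp add: power2_eq_square)
  finally show ?thesis by (simp add: r_def)
qed

end

section \<open>Color frequencies including the diagonal block\<close>

text \<open>The degree vector of the empirical graphon on block \<open>u\<close>: each of the n - 1
  other blocks has width 1/n, and the diagonal block adds 1/k to every color.\<close>

definition block_freq :: "nat \<Rightarrow> (nat set \<Rightarrow> 'k) \<Rightarrow> nat \<Rightarrow> real ^ 'k" where
  "block_freq n X u = (\<chi> a. (real (color_degree n X u a) + 1 / real CARD('k)) / real n)"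

lemma block_freq_in_simplex:
  fixes X :: "nat set \<Rightarrow> 'k::finite"
  assumes "u \<in> {1..n}"
  shows "block_freq n X u \<in> color_simplex"
  using assms sum_color_degree[OF assms, of X]
  by (intro color_simplexI)
    (auto simp: block_freq_def sum.distrib simp flip: sum_divide_distrib)

text \<open>The difference is exactly (1/k - f) / n, where f is the frequency of \<open>a\<close> in
  \<open>color_freq\<close>; both 1/k and f lie in [0,1].\<close>

lemma block_freq_color_freq:
  fixes X :: "nat set \<Rightarrow> 'k::finite"
  assumes "u \<in> {1..n}" "n \<ge> 2"
  shows "\<bar>block_freq n X u $ a - color_freq n X u $ a\<bar> \<le> 1 / real n"
proof -
  have "real (color_degree n X u a) = (real n - 1) * (color_freq n X u $ a)"
    using assms by (simp add: color_freq_def)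
  then have "real n * (block_freq n X u $ a) = (real n - 1) * (color_freq n X u $ a) + 1 / real CARD('k)"
    using assms by (simp add: block_freq_def)
  then have "block_freq n X u $ a - color_freq n X u $ a
      = (1 / real CARD('k) - color_freq n X u $ a) / real n"
    using assms by (simp add: eq_divide_eq algebra_simps)
  moreover have "0 \<le> 1 / real CARD('k)" "1 / real CARD('k) \<le> 1"
    by (simp_all add: Suc_le_eq)
  then have "\<bar>1 / real CARD('k) - color_freq n X u $ a\<bar> \<le> 1"
    using color_simplexD(1,2)[OF color_freq_in_simplex[OF assms, of X], of a] by linarith
  ultimately show ?thesis using assms by (simp add: divide_right_mono)
qed

lemma iid_block_freq_deviation:
  fixes \<mu> :: "real ^ 'k::finite"
  assumes \<mu>: "\<mu> \<in> color_simplex" and u: "u \<in> {1..n}"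
  shows "(\<Sum>X\<in>colorings n. iid_weight n \<mu> X * \<bar>block_freq n X u $ a - \<mu> $ a\<bar>)
    \<le> (sqrt (real n) + 1) / real n"
proof -
  \<comment> \<open>The centered indicator of color \<open>a\<close>. Its sum \<open>Z\<close> over
    the neighbors of \<open>u\<close> is the color degree minus (n - 1) \<mu>_a, which differs from
    n times the wanted deviation by 1/k - \<mu>_a, at most 1 in absolute value.\<close>
  define g where "g = (\<lambda>c. (if c = a then 1 else 0) - \<mu> $ a)"
  define Z where "Z = (\<lambda>X. \<Sum>v\<in>{1..n} - {u}. g (X {u, v}))"
  note D = color_simplexD[OF \<mu>]
  have n: "n > 0" using u by auto
  have "(\<Sum>c\<in>UNIV. \<mu> $ c * g c) = (\<Sum>c\<in>UNIV. if c = a then \<mu> $ c else 0) - (\<Sum>c\<in>UNIV. \<mu> $ c) * \<mu> $ a"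
    unfolding g_def sum_distrib_right sum_subtractf[symmetric]
    by (intro sum.cong refl) (auto simp: algebra_simps)
  also have "\<dots> = 0" using D by simp
  finally have g0: "(\<Sum>c\<in>UNIV. \<mu> $ c * g c) = 0" .
  have g1: "\<bar>g c\<bar> \<le> 1" for c using D(1,2)[of a] by (auto simp: g_def)
  have Z: "(\<Sum>X\<in>colorings n. iid_weight n \<mu> X * \<bar>Z X\<bar>) \<le> sqrt (real n)"
    unfolding Z_def using n by (intro iid_abs_moment iid_second_moment \<mu> u g0 g1) auto
  have dev: "\<bar>block_freq n X u $ a - \<mu> $ a\<bar> \<le> (\<bar>Z X\<bar> + 1) / real n" for X
  proof -
    have "Z X = (\<Sum>c\<in>UNIV. real (color_degree n X u c) * g c)"
      unfolding Z_def by (rule sum_neighbors_by_color)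
    also have "\<dots> = (\<Sum>c\<in>UNIV. if c = a then real (color_degree n X u c) else 0)
        - (\<Sum>c\<in>UNIV. real (color_degree n X u c)) * \<mu> $ a"
      unfolding g_def sum_distrib_right sum_subtractf[symmetric]
      by (intro sum.cong refl) (auto simp: algebra_simps)
    also have "\<dots> = real (color_degree n X u a) - (real n - 1) * \<mu> $ a"
      by (simp add: sum_color_degree[OF u])
    finally have Z_eq: "Z X = real (color_degree n X u a) - (real n - 1) * \<mu> $ a" .
    have "block_freq n X u $ a - \<mu> $ a = (Z X + (1 / real CARD('k) - \<mu> $ a)) / real n"
    proof -
      have "real n * (block_freq n X u $ a) = real (color_degree n X u a) + 1 / real CARD('k)"
        using n by (simp add: block_freq_def)
      then show ?thesis
        using n Z_eq by (simp add: eq_divide_eq algebra_simps)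
    qed
    moreover have "0 \<le> 1 / real CARD('k)" "1 / real CARD('k) \<le> 1"
      by (simp_all add: Suc_le_eq)
    then have "\<bar>Z X + (1 / real CARD('k) - \<mu> $ a)\<bar> \<le> \<bar>Z X\<bar> + 1"
      using D(1,2)[of a] by linarith
    ultimately show ?thesis using n by (simp add: divide_right_mono)
  qed
  have "(\<Sum>X\<in>colorings n. iid_weight n \<mu> X * \<bar>block_freq n X u $ a - \<mu> $ a\<bar>)
      \<le> (\<Sum>X\<in>colorings n. iid_weight n \<mu> X * ((\<bar>Z X\<bar> + 1) / real n))"
    by (intro sum_mono mult_left_mono dev iid_weight_nonneg \<mu>)
  also have "\<dots> = ((\<Sum>X\<in>colorings n. iid_weight n \<mu> X * \<bar>Z X\<bar>) + 1) / real n"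
    by (simp add: sum.distrib distrib_left sum_iid_weight[OF \<mu>] flip: sum_divide_distrib)
  also have "\<dots> \<le> (sqrt (real n) + 1) / real n" using Z n by (simp add: divide_right_mono)
  finally show ?thesis .
qed

section \<open>Bounds and limit for the partition function in block form\<close>

lemma real_choose_two: "real (n choose 2) = real n * (real n - 1) / 2"
proof -
  have "even (n * (n - 1))" by (cases n) auto
  then have "real (n choose 2) = real (n * (n - 1)) / 2"
    unfolding choose_two by (simp add: real_of_nat_div)
  then show ?thesis by (cases n) (auto simp: algebra_simps)
qed

text \<open>Replacing block frequencies by color frequencies costs L k / n per vertex, and then P
  \<le> M + I/2 supplies exactly the entropy that the weights of the colorings absorb. The number of
  profiles adds k n ln n, so the total error is O(n log n) against n^2.\<close>

lemma block_partition_upper: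
  fixes S :: "(nat ^ 'k::finite) set"
  assumes "0 \<le> L" and n: "n \<ge> 2"
    and L: "\<And>\<mu> \<nu>. \<mu> \<in> color_simplex \<Longrightarrow> \<nu> \<in> color_simplex \<Longrightarrow>
      \<bar>star_poly S \<beta> \<mu> - star_poly S \<beta> \<nu>\<bar> \<le> L * (\<Sum>a\<in>UNIV. \<bar>\<mu> $ a - \<nu> $ a\<bar>)"
    and M: "\<And>\<mu>. \<mu> \<in> color_simplex \<Longrightarrow> star_poly S \<beta> \<mu> - 1 / 2 * entropy_fun \<mu> \<le> M"
  shows "ln (\<Sum>X\<in>colorings n. exp (real n * (\<Sum>u\<in>{1..n}. star_poly S \<beta> (block_freq n X u))))
    \<le> (real n)\<^sup>2 * M + real n * (L * real CARD('k) + real CARD('k) * ln (real n))"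
proof -
  let ?f = "\<lambda>X. real n * (\<Sum>u\<in>{1..n}. star_poly S \<beta> (block_freq n X u))"
  let ?B = "(real n)\<^sup>2 * M + real n * (L * real CARD('k))"
  have "?f X \<le> ?B + 1 / 2 * (real n - 1) * (\<Sum>u\<in>{1..n}. entropy_fun (color_freq n X u))"
    for X :: "nat set \<Rightarrow> 'k"
  proof -
    have vertex: "star_poly S \<beta> (block_freq n X u)
        \<le> M + L * real CARD('k) / real n + 1 / 2 * entropy_fun (color_freq n X u)"
      if u: "u \<in> {1..n}" for u
    proof -
      have "\<bar>star_poly S \<beta> (block_freq n X u) - star_poly S \<beta> (color_freq n X u)\<bar>
          \<le> L * (\<Sum>a\<in>UNIV. \<bar>block_freq n X u $ a - color_freq n X u $ a\<bar>)"
        by (intro L block_freq_in_simplex color_freq_in_simplex u n)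
      also have "\<dots> \<le> L * (\<Sum>a\<in>(UNIV :: 'k set). 1 / real n)"
        by (intro mult_left_mono sum_mono block_freq_color_freq u n \<open>0 \<le> L\<close>)
      finally have "star_poly S \<beta> (block_freq n X u)
          \<le> star_poly S \<beta> (color_freq n X u) + L * real CARD('k) / real n" by simp
      with M[OF color_freq_in_simplex[OF u n, of X]] show ?thesis by linarith
    qed
    let ?E = "\<Sum>u\<in>{1..n}. entropy_fun (color_freq n X u)"
    have "?f X \<le> real n * (\<Sum>u\<in>{1..n}. M + L * real CARD('k) / real n
        + 1 / 2 * entropy_fun (color_freq n X u))"
      by (intro mult_left_mono sum_mono vertex) auto
    also have "\<dots> = ?B + 1 / 2 * real n * ?E"
      using n by (simp add: sum.distrib algebra_simps power2_eq_square flip: sum_divide_distrib)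
    \<comment> \<open>A vertex has only n - 1 half-edges. Lowering the factor from n to n - 1
      increases the term because entropies are at most 0.\<close>
    also have "1 / 2 * real n * ?E \<le> 1 / 2 * (real n - 1) * ?E"
      using n by (intro mult_right_mono_neg sum_nonpos entropy_fun_bounds color_freq_in_simplex) auto
    finally show ?thesis by simp
  qed
  then have "(\<Sum>X\<in>colorings n. exp (?f X)) \<le> exp ?B * real n ^ (CARD('k) * n)"
    by (intro sum_exp_colorings_le n)
  moreover have "0 < (\<Sum>X\<in>colorings n. exp (?f X))"
    using colorings_nonempty by (intro sum_pos) auto
  ultimately have "ln (\<Sum>X\<in>colorings n. exp (?f X)) \<le> ln (exp ?B * real n ^ (CARD('k) * n))"
    by simp
  also have "\<dots> = ?B + real (CARD('k) * n) * ln (real n)"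
    using n by (subst ln_mult) (auto simp: ln_realpow)
  finally show ?thesis by (simp add: algebra_simps)
qed

text \<open>Take the independent coloring of law \<mu> as trial law in the Gibbs principle. Its
  entropy is exact, and by the Lipschitz bound the expected value of P at a vertex is off by at most
  L k times the mean deviation of the degrees; the total error is of order n^(3/2).\<close>

lemma block_partition_lower:
  fixes S :: "(nat ^ 'k::finite) set"
  assumes "0 \<le> L" and n: "n \<ge> 1" and \<mu>: "\<mu> \<in> color_simplex"
    and L: "\<And>\<mu> \<nu>. \<mu> \<in> color_simplex \<Longrightarrow> \<nu> \<in> color_simplex \<Longrightarrow>
      \<bar>star_poly S \<beta> \<mu> - star_poly S \<beta> \<nu>\<bar> \<le> L * (\<Sum>a\<in>UNIV. \<bar>\<mu> $ a - \<nu> $ a\<bar>)"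
  shows "(real n)\<^sup>2 * star_poly S \<beta> \<mu> - real n * (L * real CARD('k) * (sqrt (real n) + 1))
      - real n * (real n - 1) / 2 * entropy_fun \<mu>
    \<le> ln (\<Sum>X\<in>colorings n. exp (real n * (\<Sum>u\<in>{1..n}. star_poly S \<beta> (block_freq n X u))))"
proof -
  let ?f = "\<lambda>X. real n * (\<Sum>u\<in>{1..n}. star_poly S \<beta> (block_freq n X u))"
  let ?q = "iid_weight n \<mu>"
  let ?\<delta> = "L * real CARD('k) * ((sqrt (real n) + 1) / real n)"
  have vertex: "star_poly S \<beta> \<mu> - ?\<delta> \<le> (\<Sum>X\<in>colorings n. ?q X * star_poly S \<beta> (block_freq n X u))"
    if u: "u \<in> {1..n}" for u
  proof -
    have "(\<Sum>X\<in>colorings n. ?q X * (star_poly S \<beta> \<mu>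
          - L * (\<Sum>a\<in>UNIV. \<bar>block_freq n X u $ a - \<mu> $ a\<bar>)))
        \<le> (\<Sum>X\<in>colorings n. ?q X * star_poly S \<beta> (block_freq n X u))"
    proof (intro sum_mono mult_left_mono iid_weight_nonneg \<mu>)
      fix X :: "nat set \<Rightarrow> 'k"
      show "star_poly S \<beta> \<mu> - L * (\<Sum>a\<in>UNIV. \<bar>block_freq n X u $ a - \<mu> $ a\<bar>)
          \<le> star_poly S \<beta> (block_freq n X u)"
        using L[OF block_freq_in_simplex[OF u, of X] \<mu>] by linarith
    qed
    moreover have "(\<Sum>X\<in>colorings n. ?q X * (star_poly S \<beta> \<mu>
          - L * (\<Sum>a\<in>UNIV. \<bar>block_freq n X u $ a - \<mu> $ a\<bar>)))
        = star_poly S \<beta> \<mu>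
          - L * (\<Sum>a\<in>UNIV. \<Sum>X\<in>colorings n. ?q X * \<bar>block_freq n X u $ a - \<mu> $ a\<bar>)"
    proof -
      have "(\<Sum>X\<in>colorings n. ?q X * star_poly S \<beta> \<mu>) = star_poly S \<beta> \<mu>"
        by (simp add: sum_iid_weight[OF \<mu>] flip: sum_distrib_right)
      then show ?thesis
        by (subst sum.swap) (simp add: right_diff_distrib sum_subtractf sum_distrib_left mult.left_commute)
    qed
    moreover have "L * (\<Sum>a\<in>UNIV. \<Sum>X\<in>colorings n. ?q X * \<bar>block_freq n X u $ a - \<mu> $ a\<bar>)
        \<le> L * (\<Sum>a\<in>(UNIV :: 'k set). (sqrt (real n) + 1) / real n)"
      by (intro mult_left_mono sum_mono iid_block_freq_deviation \<mu> u \<open>0 \<le> L\<close>)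
    ultimately show ?thesis by simp
  qed
  have "(real n)\<^sup>2 * star_poly S \<beta> \<mu> - real n * (L * real CARD('k) * (sqrt (real n) + 1))
      = real n * (\<Sum>u\<in>{1..n}. star_poly S \<beta> \<mu> - ?\<delta>)"
    using n by (simp add: power2_eq_square field_simps)
  also have "\<dots> \<le> real n * (\<Sum>u\<in>{1..n}. \<Sum>X\<in>colorings n. ?q X * star_poly S \<beta> (block_freq n X u))"
    by (intro mult_left_mono sum_mono vertex) auto
  also have "\<dots> = (\<Sum>X\<in>colorings n. ?q X * ?f X)"
    by (subst sum.swap) (simp add: sum_distrib_left mult_ac)
  finally have "(real n)\<^sup>2 * star_poly S \<beta> \<mu> - real n * (L * real CARD('k) * (sqrt (real n) + 1))
      \<le> (\<Sum>X\<in>colorings n. ?q X * ?f X)" .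
  moreover have "(\<Sum>X\<in>colorings n. ?q X * ?f X) - (\<Sum>X\<in>colorings n. ?q X * ln (?q X))
      \<le> ln (\<Sum>X\<in>colorings n. exp (?f X))"
    by (intro gibbs_variational_ge iid_weight_nonneg sum_iid_weight \<mu> finite_colorings)
  ultimately show ?thesis unfolding iid_entropy[OF \<mu>] real_choose_two by linarith
qed

lemma block_partition_limit:
  fixes S :: "(nat ^ 'k::finite) set"
  shows "(\<lambda>n. 1 / (real n)\<^sup>2 * ln (\<Sum>X\<in>colorings n.
      exp (real n * (\<Sum>u\<in>{1..n}. star_poly S \<beta> (block_freq n X u)))))
    \<longlonglongrightarrow> (SUP \<mu>\<in>color_simplex. star_poly S \<beta> \<mu> - 1 / 2 * entropy_fun \<mu>)"
    (is "?\<psi> \<longlonglongrightarrow> ?M")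
proof (rule order_tendstoI)
  obtain L where L: "0 \<le> L" "\<And>\<mu> \<nu>. \<mu> \<in> color_simplex \<Longrightarrow> \<nu> \<in> color_simplex \<Longrightarrow>
      \<bar>star_poly S \<beta> \<mu> - star_poly S \<beta> \<nu>\<bar> \<le> L * (\<Sum>a\<in>UNIV. \<bar>\<mu> $ a - \<nu> $ a\<bar>)"
    using star_poly_lipschitz[of S \<beta>] by blast
  define K where "K = real CARD('k)"
  {
    fix m assume "?M < m"
    have "(\<lambda>n. ?M + (L * K * (1 / real n) + K * (ln (real n) / real n)))
        \<longlonglongrightarrow> ?M + (L * K * 0 + K * 0)"
      by (intro tendsto_intros)
    then have "(\<lambda>n. ?M + (L * K + K * ln (real n)) / real n) \<longlonglongrightarrow> ?M"
      by (simp add: add_divide_distrib)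
    then have "eventually (\<lambda>n. ?M + (L * K + K * ln (real n)) / real n < m) sequentially"
      using \<open>?M < m\<close> by (rule order_tendstoD)
    moreover have "eventually (\<lambda>n::nat. n \<ge> 2) sequentially" by (rule eventually_ge_at_top)
    ultimately show "eventually (\<lambda>n. ?\<psi> n < m) sequentially"
    proof eventually_elim
      case (elim n)
      have "?\<psi> n \<le> 1 / (real n)\<^sup>2 * ((real n)\<^sup>2 * ?M + real n * (L * K + K * ln (real n)))"
        unfolding K_def
        by (intro mult_left_mono block_partition_upper L elim cSUP_upper bdd_above_free_energy) auto
      also have "\<dots> = ?M + (L * K + K * ln (real n)) / real n"
        using elim by (simp add: power2_eq_square distrib_left add_divide_distrib)
      finally show ?case using elim by simp
    qed
  next
    fix m assume "m < ?M"
    \<comment> \<open>Fix a near-maximizer first and let n grow afterwards: the lower bound then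
      tends to its value, which exceeds \<open>m\<close>.\<close>
    then obtain \<mu> :: "real ^ 'k" where \<mu>: "\<mu> \<in> color_simplex"
      "m < star_poly S \<beta> \<mu> - 1 / 2 * entropy_fun \<mu>"
      using less_cSUP_iff[OF color_simplex_nonempty bdd_above_free_energy] by blast
    define P I where "P = star_poly S \<beta> \<mu>" and "I = entropy_fun \<mu>"
    let ?lower = "\<lambda>n::nat. P - L * K * (sqrt (real n) + 1) / real n - (real n - 1) / (2 * real n) * I"
    have "(\<lambda>n. P - L * K * ((sqrt (real n) + 1) / real n) - (real n - 1) / (2 * real n) * I)
        \<longlonglongrightarrow> P - L * K * 0 - 1 / 2 * I"
      by (intro tendsto_diff tendsto_mult tendsto_const) real_asymp+
    then have "?lower \<longlonglongrightarrow> P - 1 / 2 * I" by simp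
    then have "eventually (\<lambda>n. m < ?lower n) sequentially"
      using \<mu>(2) unfolding P_def I_def by (rule order_tendstoD)
    moreover have "eventually (\<lambda>n::nat. n \<ge> 1) sequentially" by (rule eventually_ge_at_top)
    ultimately show "eventually (\<lambda>n. m < ?\<psi> n) sequentially"
    proof eventually_elim
      case (elim n)
      have "?lower n = 1 / (real n)\<^sup>2 * ((real n)\<^sup>2 * P - real n * (L * K * (sqrt (real n) + 1))
          - real n * (real n - 1) / 2 * I)"
        using elim by (simp add: power2_eq_square field_simps)
      also have "\<dots> \<le> ?\<psi> n"
        unfolding K_def P_def I_def
        by (intro mult_left_mono block_partition_lower L elim \<mu>) auto
      finally show ?case using elim by linarith
    qed
  }
qed

section \<open>Degrees of graphons\<close>

interpretation unit: prob_space unit_measure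
  by (rule prob_spaceI) (simp add: emeasure_restrict_space)

interpretation unit_pair: pair_prob_space unit_measure unit_measure ..

interpretation unit_prod: product_sigma_finite "\<lambda>_. unit_measure" ..

lemma unit_integrable_bounded:
  fixes f :: "real \<Rightarrow> real"
  assumes "f \<in> borel_measurable unit_measure" "\<And>x. x \<in> {0..1} \<Longrightarrow> \<bar>f x\<bar> \<le> B"
  shows "integrable unit_measure f"
  using assms by (intro unit.integrable_const_bound[of _ B]) (auto intro!: AE_I2)

lemma unit_pair_integrable_bounded:
  fixes f :: "real \<times> real \<Rightarrow> real"
  assumes "f \<in> borel_measurable (unit_measure \<Otimes>\<^sub>M unit_measure)"
    "\<And>x y. x \<in> {0..1} \<Longrightarrow> y \<in> {0..1} \<Longrightarrow> \<bar>f (x, y)\<bar> \<le> B"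
  shows "integrable (unit_measure \<Otimes>\<^sub>M unit_measure) f"
  using assms by (intro unit_pair.integrable_const_bound[of _ B]) (auto intro!: AE_I2 simp: space_pair_measure)

lemma borel_measurable_vec_iff:
  fixes f :: "'a \<Rightarrow> real ^ 'k::finite"
  shows "f \<in> borel_measurable M \<longleftrightarrow> (\<forall>a. (\<lambda>x. f x $ a) \<in> borel_measurable M)"
  by (subst borel_measurable_euclidean_space) (auto simp: Basis_vec_def inner_axis)

lemma borel_measurable_vec_nth' [measurable]:
  fixes f :: "'a \<Rightarrow> real ^ 'k::finite"
  assumes "f \<in> borel_measurable M"
  shows "(\<lambda>x. f x $ a) \<in> borel_measurable M"
  using assms by (simp add: borel_measurable_vec_iff)

lemma entropy_fun_measurable [measurable]:
  fixes f :: "'a \<Rightarrow> real ^ 'k::finite"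
  assumes [measurable]: "f \<in> borel_measurable M"
  shows "(\<lambda>x. entropy_fun (f x)) \<in> borel_measurable M"
  unfolding entropy_fun_def by measurable

lemma star_poly_measurable [measurable]:
  fixes f :: "'a \<Rightarrow> real ^ 'k::finite"
  assumes [measurable]: "f \<in> borel_measurable M"
  shows "(\<lambda>x. star_poly S \<beta> (f x)) \<in> borel_measurable M"
  unfolding star_poly_def by measurable

section \<open>Degree vectors and the Hellinger defect\<close>

definition graphon_degree :: "(real \<times> real \<Rightarrow> real ^ 'k) \<Rightarrow> real \<Rightarrow> real ^ 'k" where
  "graphon_degree W x = (\<chi> a. LINT y | unit_measure. W (x, y) $ a)"

text \<open>Twice the squared Hellinger distance.\<close>

definition hellinger :: "real ^ 'k \<Rightarrow> real ^ 'k \<Rightarrow> real" where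
  "hellinger w d = (\<Sum>a\<in>UNIV. (sqrt (w $ a) - sqrt (d $ a))\<^sup>2)"

lemma hellinger_nonneg: "0 \<le> hellinger w d"
  unfolding hellinger_def by (intro sum_nonneg) auto

text \<open>True for all real vectors because \<open>sqrt\<close> is extended to negative numbers as
  an odd injective function.\<close>

lemma hellinger_eq_0_iff:
  fixes w d :: "real ^ 'k::finite"
  shows "hellinger w d = 0 \<longleftrightarrow> w = d"
  unfolding hellinger_def vec_eq_iff by (subst sum_nonneg_eq_0_iff) auto

lemma abs_hellinger_le:
  fixes w d :: "real ^ 'k::finite"
  assumes "w \<in> color_simplex" "d \<in> color_simplex"
  shows "\<bar>hellinger w d\<bar> \<le> real CARD('k)"
proof -
  have "hellinger w d \<le> (\<Sum>a\<in>(UNIV :: 'k set). 1)"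
    unfolding hellinger_def
  proof (rule sum_mono)
    fix a
    have "\<bar>sqrt (w $ a) - sqrt (d $ a)\<bar> \<le> 1"
      using color_simplexD(1,2)[OF assms(1), of a] color_simplexD(1,2)[OF assms(2), of a]
        real_sqrt_le_1_iff[of "w $ a"] real_sqrt_le_1_iff[of "d $ a"]
        real_sqrt_ge_zero[of "w $ a"] real_sqrt_ge_zero[of "d $ a"] by linarith
    then show "(sqrt (w $ a) - sqrt (d $ a))\<^sup>2 \<le> 1" by (simp add: abs_square_le_1)
  qed
  then show ?thesis using hellinger_nonneg[of w d] by simp
qed

lemma hellinger_measurable [measurable]:
  fixes f g :: "'a \<Rightarrow> real ^ 'k::finite"
  assumes [measurable]: "f \<in> borel_measurable M" "g \<in> borel_measurable M"
  shows "(\<lambda>x. hellinger (f x) (g x)) \<in> borel_measurable M"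
  unfolding hellinger_def by measurable

lemma constant_in_prob_graphons:
  "\<mu> \<in> color_simplex \<Longrightarrow> (\<lambda>_. \<mu>) \<in> prob_graphons"
  by (simp add: prob_graphons_def)

section \<open>Star densities of a graphon\<close>

text \<open>\<open>SOME\<close> may return either order of the endpoints; symmetry at this pair
  makes both orders give the same value.\<close>

lemma edge_factor_doubleton:
  assumes "W (x u, x v) = W (x v, x u)"
  shows "edge_factor W x {u, v} a = W (x u, x v) $ a"
proof -
  obtain u' v' where some: "(SOME (s, t). {u, v} = {s, t}) = (u', v')" by (meson surj_pair)
  have "case (SOME (s, t). {u, v} = {s, t}) of (s, t) \<Rightarrow> {u, v} = {s, t}"
    by (rule someI[of _ "(u, v)"]) simp
  then have "{u, v} = {u', v'}" by (simp add: some)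
  then have "u' = u \<and> v' = v \<or> u' = v \<and> v' = u" by (auto simp: doubleton_eq_iff)
  then show ?thesis using assms by (auto simp: edge_factor_def some)
qed

context
  fixes W :: "real \<times> real \<Rightarrow> real ^ 'k::finite"
  assumes W: "W \<in> prob_graphons"
begin

lemma graphon_in_simplex: "x \<in> {0..1} \<Longrightarrow> y \<in> {0..1} \<Longrightarrow> W (x, y) \<in> color_simplex"
  using W by (auto simp: prob_graphons_def)

lemma graphon_symmetric: "x \<in> {0..1} \<Longrightarrow> y \<in> {0..1} \<Longrightarrow> W (x, y) = W (y, x)"
  using W by (auto simp: prob_graphons_def)

text \<open>Measurability of \<open>W\<close> is known only on the unit square, so compositions must
  be shown to land there.\<close>

lemma graphon_measurable:
  assumes "f \<in> borel_measurable M" "g \<in> borel_measurable M"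
    "\<And>x. x \<in> space M \<Longrightarrow> f x \<in> {0..1} \<and> g x \<in> {0..1}"
  shows "(\<lambda>x. W (f x, g x)) \<in> borel_measurable M"
proof (rule measurable_compose[of "\<lambda>x. (f x, g x)" M "restrict_space borel ({0..1} \<times> {0..1})" W])
  show "(\<lambda>x. (f x, g x)) \<in> M \<rightarrow>\<^sub>M restrict_space borel ({0..1} \<times> {0..1})"
    using assms by (intro measurable_restrict_space2 borel_measurable_Pair) auto
  show "W \<in> borel_measurable (restrict_space borel ({0..1} \<times> {0..1}))"
    using W by (simp add: prob_graphons_def)
qed

lemma id_unit_measurable: "(\<lambda>x. x) \<in> borel_measurable unit_measure"
  by (intro measurable_restrict_space1) simp

lemma graphon_measurable_pair: "W \<in> borel_measurable (unit_measure \<Otimes>\<^sub>M unit_measure)"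
proof -
  have "(\<lambda>p. W (fst p, snd p)) \<in> borel_measurable (unit_measure \<Otimes>\<^sub>M unit_measure)"
    by (intro graphon_measurable measurable_compose[OF measurable_fst id_unit_measurable]
        measurable_compose[OF measurable_snd id_unit_measurable]) (auto simp: space_pair_measure)
  then show ?thesis by simp
qed

lemma graphon_component_measurable_pair:
  "(\<lambda>p. W p $ a) \<in> borel_measurable (unit_measure \<Otimes>\<^sub>M unit_measure)"
  using graphon_measurable_pair by (simp add: borel_measurable_vec_iff)

lemma graphon_section_measurable: "x \<in> {0..1} \<Longrightarrow> (\<lambda>y. W (x, y)) \<in> borel_measurable unit_measure"
  by (intro graphon_measurable id_unit_measurable) auto

lemma graphon_section_integrable:
  "x \<in> {0..1} \<Longrightarrow> integrable unit_measure (\<lambda>y. W (x, y) $ a)"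
  using graphon_section_measurable[of x] color_simplexD(1,2)[OF graphon_in_simplex[of x]]
  by (intro unit_integrable_bounded[of _ 1]) (auto simp: borel_measurable_vec_iff)

lemma graphon_degree_measurable: "graphon_degree W \<in> borel_measurable unit_measure"
  unfolding borel_measurable_vec_iff graphon_degree_def
  using graphon_component_measurable_pair
  by (auto intro!: unit.borel_measurable_lebesgue_integral simp: case_prod_beta)

lemma graphon_degree_in_simplex:
  assumes x: "x \<in> {0..1}"
  shows "graphon_degree W x \<in> color_simplex"
proof (rule color_simplexI)
  fix a
  show "0 \<le> graphon_degree W x $ a"
    using color_simplexD(1)[OF graphon_in_simplex[OF x]]
    by (auto simp: graphon_degree_def intro!: integral_nonneg_AE AE_I2)
next
  have "(\<Sum>a\<in>UNIV. graphon_degree W x $ a) = (LINT y | unit_measure. (\<Sum>a\<in>UNIV. W (x, y) $ a))"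
    using graphon_section_integrable[OF x]
    by (simp add: graphon_degree_def Bochner_Integration.integral_sum)
  also have "\<dots> = (LINT y | unit_measure. 1)"
    using color_simplexD(3)[OF graphon_in_simplex[OF x]] by (intro Bochner_Integration.integral_cong) auto
  finally show "(\<Sum>a\<in>UNIV. graphon_degree W x $ a) = 1"
    using unit.prob_space by simp
qed

text \<open>With the center fixed at x, the leaves are independent coordinates, so the inner
  integral is a product with one factor, the degree of x in the color of the edge, for every
  leaf.\<close>

lemma hom_density_star:
  "hom_density (colored_star s) W = (LINT x | unit_measure. (\<Prod>a\<in>UNIV. (graphon_degree W x $ a) ^ (s $ a)))"
proof -
  define J where "J = {(a, i). i < s $ a}"
  have J: "J = Sigma UNIV (\<lambda>a. {..<s $ a})" by (auto simp: J_def)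
  have finJ: "finite J" unfolding J by simp
  let ?I = "Some ` J"
  let ?U = "\<lambda>_ :: ('k \<times> nat) option. unit_measure"
  \<comment> \<open>The center is a separate argument, so that \<open>F x z\<close> ignores the
    coordinate \<open>None\<close> of \<open>z\<close>.\<close>
  define F where "F = (\<lambda>x z. \<Prod>p\<in>J. W (x, z (Some p)) $ fst p)"
  interpret PI: prob_space "Pi\<^sub>M ?I ?U" by (intro prob_space_PiM unit.prob_space_axioms)
  interpret PN: prob_space "Pi\<^sub>M (insert None ?I) ?U" by (intro prob_space_PiM unit.prob_space_axioms)
  interpret PP: pair_prob_space unit_measure "Pi\<^sub>M ?I ?U" ..
  have bound: "\<bar>F x z\<bar> \<le> 1" if "x \<in> {0..1}" "\<And>p. p \<in> J \<Longrightarrow> z (Some p) \<in> {0..1}" for x z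
    unfolding F_def abs_prod
    using color_simplexD(1,2)[OF graphon_in_simplex] that by (intro prod_le_1) auto
  have comp: "(\<lambda>z. z i) \<in> borel_measurable (Pi\<^sub>M A ?U)" if "i \<in> A" for i A
    by (rule measurable_compose[OF measurable_component_singleton[OF that] id_unit_measurable])
  have meas: "(\<lambda>z. F (f z) (g z)) \<in> borel_measurable M"
    if "f \<in> borel_measurable M" "\<And>p. p \<in> J \<Longrightarrow> (\<lambda>z. g z (Some p)) \<in> borel_measurable M"
      "\<And>z. z \<in> space M \<Longrightarrow> f z \<in> {0..1} \<and> (\<forall>p\<in>J. g z (Some p) \<in> {0..1})"
    for M :: "'b measure" and f g
    unfolding F_def
    using graphon_measurable[OF that(1,2)] that(3)
    by (intro borel_measurable_prod) (auto simp: borel_measurable_vec_iff)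
  have "hom_density (colored_star s) W = (LINT z | Pi\<^sub>M (insert None ?I) ?U. F (z None) z)"
    unfolding hom_density_def
  proof (intro Bochner_Integration.integral_cong)
    fix z assume "z \<in> space (Pi\<^sub>M (insert None ?I) ?U)"
    then have z: "z i \<in> {0..1}" if "i \<in> insert None ?I" for i
      using that by (auto simp: colored_star_def space_PiM PiE_iff J_def)
    have "(\<Prod>e\<in>cg_edges (colored_star s). edge_factor W z e (cg_color (colored_star s) e))
        = (\<Prod>p\<in>J. edge_factor W z {None, Some p} (cg_color (colored_star s) {None, Some p}))"
      by (simp add: colored_star_def J_def[symmetric])
        (subst prod.reindex, auto simp: inj_on_def doubleton_eq_iff)
    also have "\<dots> = F (z None) z"
      unfolding F_def
    proof (rule prod.cong[OF refl])
      fix p assume "p \<in> J"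
      have "cg_color (colored_star s) {None, Some p} = fst p"
        by (auto simp: colored_star_def intro!: the_equality) (metis prod.collapse)
      then show "edge_factor W z {None, Some p} (cg_color (colored_star s) {None, Some p})
          = W (z None, z (Some p)) $ fst p"
        using z \<open>p \<in> J\<close> by (simp add: edge_factor_doubleton graphon_symmetric)
    qed
    finally show "(\<Prod>e\<in>cg_edges (colored_star s). edge_factor W z e (cg_color (colored_star s) e))
        = F (z None) z" .
  qed (simp add: colored_star_def J_def)
  \<comment> \<open>Splitting off the coordinate \<open>None\<close> puts the center innermost;
    Fubini then moves it outside.\<close>
  also have "\<dots> = (LINT z | Pi\<^sub>M ?I ?U. LINT x | unit_measure. F x z)"
  proof -
    have "integrable (Pi\<^sub>M (insert None ?I) ?U) (\<lambda>z. F (z None) z)"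
      by (intro PN.integrable_const_bound[of _ 1] AE_I2 meas comp)
        (auto simp: space_PiM PiE_iff intro!: bound)
    then have "(LINT z | Pi\<^sub>M (insert None ?I) ?U. F (z None) z)
        = (LINT z | Pi\<^sub>M ?I ?U. LINT x | unit_measure. F ((z(None := x)) None) (z(None := x)))"
      using finJ by (intro unit_prod.product_integral_insert) auto
    then show ?thesis by (simp add: F_def)
  qed
  also have "\<dots> = (LINT x | unit_measure. LINT z | Pi\<^sub>M ?I ?U. F x z)"
  proof (rule PP.Fubini_integral)
    have "(\<lambda>q. F (fst q) (snd q)) \<in> borel_measurable (unit_measure \<Otimes>\<^sub>M Pi\<^sub>M ?I ?U)"
      by (intro meas measurable_compose[OF measurable_fst id_unit_measurable]
          measurable_compose[OF measurable_snd comp])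
        (auto simp: space_pair_measure space_PiM PiE_iff)
    then show "integrable (unit_measure \<Otimes>\<^sub>M Pi\<^sub>M ?I ?U) (case_prod F)"
      by (intro PP.integrable_const_bound[of _ 1] AE_I2)
        (auto simp: space_pair_measure space_PiM PiE_iff case_prod_beta intro!: bound)
  qed
  also have "\<dots> = (LINT x | unit_measure. (\<Prod>a\<in>UNIV. (graphon_degree W x $ a) ^ (s $ a)))"
  proof (rule Bochner_Integration.integral_cong[OF refl])
    fix x assume "x \<in> space unit_measure"
    then have x: "x \<in> {0..1}" by simp
    have "(LINT z | Pi\<^sub>M ?I ?U. F x z) = (LINT z | Pi\<^sub>M ?I ?U. (\<Prod>i\<in>?I. W (x, z i) $ fst (the i)))"
      by (simp add: F_def prod.reindex)
    also have "\<dots> = (\<Prod>i\<in>?I. LINT y | unit_measure. W (x, y) $ fst (the i))"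
      using finJ graphon_section_integrable[OF x]
      by (intro unit_prod.product_integral_prod) auto
    also have "\<dots> = (\<Prod>p\<in>J. graphon_degree W x $ fst p)"
      by (simp add: prod.reindex graphon_degree_def)
    also have "\<dots> = (\<Prod>a\<in>UNIV. \<Prod>i\<in>{..<s $ a}. graphon_degree W x $ a)"
      unfolding J by (subst prod.Sigma) (auto simp: case_prod_beta)
    finally show "(LINT z | Pi\<^sub>M ?I ?U. F x z) = (\<Prod>a\<in>UNIV. (graphon_degree W x $ a) ^ (s $ a))"
      by simp
  qed
  finally show ?thesis .
qed

lemma star_functional_eq:
  "star_functional S \<beta> W = (LINT x | unit_measure. star_poly S \<beta> (graphon_degree W x))"
proof -
  have "integrable unit_measure (\<lambda>x. \<Prod>a\<in>UNIV. (graphon_degree W x $ a) ^ (s $ a))" for s :: "nat ^ 'k"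
  proof (rule unit_integrable_bounded[of _ 1])
    show "(\<lambda>x. \<Prod>a\<in>UNIV. (graphon_degree W x $ a) ^ (s $ a)) \<in> borel_measurable unit_measure"
      by (intro borel_measurable_prod borel_measurable_power borel_measurable_vec_nth'
          graphon_degree_measurable)
    show "\<bar>\<Prod>a\<in>UNIV. (graphon_degree W x $ a) ^ (s $ a)\<bar> \<le> 1" if "x \<in> {0..1}" for x
      unfolding abs_prod using color_simplexD(1,2)[OF graphon_degree_in_simplex[OF that]]
      by (intro prod_le_1) (auto simp: power_le_one)
  qed
  then show ?thesis
    unfolding star_functional_def star_poly_def hom_density_star
    by (subst Bochner_Integration.integral_sum) auto
qed

lemma star_poly_degree_integrable:
  "integrable unit_measure (\<lambda>x. star_poly S \<beta> (graphon_degree W x))"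
  using star_poly_bounded[OF graphon_degree_in_simplex]
  by (intro unit_integrable_bounded[of _ "\<Sum>s\<in>S. \<bar>\<beta> s\<bar>"] star_poly_measurable graphon_degree_measurable) auto

lemma entropy_degree_integrable:
  "integrable unit_measure (\<lambda>x. entropy_fun (graphon_degree W x))"
  using entropy_fun_bounds[OF graphon_degree_in_simplex]
  by (intro unit_integrable_bounded[of _ "real CARD('k)"] entropy_fun_measurable graphon_degree_measurable)
    (fastforce simp: abs_le_iff)

lemma entropy_graphon_integrable:
  "integrable (unit_measure \<Otimes>\<^sub>M unit_measure) (\<lambda>p. entropy_fun (W p))"
  using entropy_fun_bounds[OF graphon_in_simplex]
  by (intro unit_pair_integrable_bounded[of _ "real CARD('k)"] entropy_fun_measurable graphon_measurable_pair)
    (fastforce simp: abs_le_iff)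

lemma hellinger_graphon_integrable:
  "integrable (unit_measure \<Otimes>\<^sub>M unit_measure) (\<lambda>p. hellinger (W p) (graphon_degree W (fst p)))"
  using abs_hellinger_le[OF graphon_in_simplex graphon_degree_in_simplex]
  by (intro unit_pair_integrable_bounded[of _ "real CARD('k)"] hellinger_measurable graphon_measurable_pair
      measurable_compose[OF measurable_fst graphon_degree_measurable]) auto

section \<open>The entropy of a graphon compared with that of its degrees\<close>

text \<open>Jensen's inequality in the row of x with its defect kept: integrate the Hellinger bound
  over y. The mean of the row is the degree vector d, so the linear term in W integrates to the
  entropy of d.\<close>

lemma entropy_section_ge:
  assumes x: "x \<in> {0..1}"
  shows "entropy_fun (graphon_degree W x) + (LINT y | unit_measure. hellinger (W (x, y)) (graphon_degree W x))
    \<le> (LINT y | unit_measure. entropy_fun (W (x, y)))"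
proof -
  let ?d = "graphon_degree W x"
  note d = graphon_degree_in_simplex[OF x]
  have int_ln: "integrable unit_measure (\<lambda>y. \<Sum>a\<in>UNIV. W (x, y) $ a * ln (?d $ a))"
    using graphon_section_integrable[OF x] by auto
  have int_H: "integrable unit_measure (\<lambda>y. hellinger (W (x, y)) ?d)"
    using abs_hellinger_le[OF graphon_in_simplex[OF x] d]
    by (intro unit_integrable_bounded[of _ "real CARD('k)"] hellinger_measurable
        graphon_section_measurable x) auto
  have int_E: "integrable unit_measure (\<lambda>y. entropy_fun (W (x, y)))"
    using entropy_fun_bounds[OF graphon_in_simplex[OF x]]
    by (intro unit_integrable_bounded[of _ "real CARD('k)"] entropy_fun_measurable
        graphon_section_measurable x) (fastforce simp: abs_le_iff)
  \<comment> \<open>A nonnegative function with integral 0 vanishes almost everywhere; this gives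
    the support hypothesis of the Hellinger bound.\<close>
  have "AE y in unit_measure. ?d $ a = 0 \<longrightarrow> W (x, y) $ a = 0" for a
  proof (cases "?d $ a = 0")
    case True
    then have "(LINT y | unit_measure. W (x, y) $ a) = 0" by (simp add: graphon_degree_def)
    then show ?thesis
      using color_simplexD(1)[OF graphon_in_simplex[OF x]]
      by (subst (asm) integral_nonneg_eq_0_iff_AE[OF graphon_section_integrable[OF x]]) (auto intro!: AE_I2)
  qed simp
  then have supp: "AE y in unit_measure. \<forall>a\<in>UNIV. ?d $ a = 0 \<longrightarrow> W (x, y) $ a = 0"
    by (intro AE_finite_allI) auto
  have "(LINT y | unit_measure. hellinger (W (x, y)) ?d + (\<Sum>a\<in>UNIV. W (x, y) $ a * ln (?d $ a)))
      \<le> (LINT y | unit_measure. entropy_fun (W (x, y)))"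
  proof (rule integral_mono_AE[OF Bochner_Integration.integrable_add[OF int_H int_ln] int_E])
    show "AE y in unit_measure. hellinger (W (x, y)) ?d + (\<Sum>a\<in>UNIV. W (x, y) $ a * ln (?d $ a))
        \<le> entropy_fun (W (x, y))"
      using supp AE_space
    proof eventually_elim
      case (elim y)
      then have "hellinger (W (x, y)) ?d \<le> entropy_fun (W (x, y)) - (\<Sum>a\<in>UNIV. W (x, y) $ a * ln (?d $ a))"
        unfolding hellinger_def using d x
        by (intro relative_entropy_ge_hellinger graphon_in_simplex) auto
      then show ?case by linarith
    qed
  qed
  moreover have "(LINT y | unit_measure. (\<Sum>a\<in>UNIV. W (x, y) $ a * ln (?d $ a))) = entropy_fun ?d"
    using graphon_section_integrable[OF x]
    by (subst Bochner_Integration.integral_sum) (auto simp: entropy_fun_def graphon_degree_def)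
  ultimately show ?thesis using int_H int_ln by simp
qed

lemma graphon_entropy_ge:
  "(LINT x | unit_measure. entropy_fun (graphon_degree W x))
      + (LINT p | (unit_measure \<Otimes>\<^sub>M unit_measure). hellinger (W p) (graphon_degree W (fst p)))
    \<le> graphon_entropy W"
proof -
  note E = entropy_graphon_integrable and H = hellinger_graphon_integrable
  have "(LINT x | unit_measure. entropy_fun (graphon_degree W x))
      + (LINT p | (unit_measure \<Otimes>\<^sub>M unit_measure). hellinger (W p) (graphon_degree W (fst p)))
    = (LINT x | unit_measure. entropy_fun (graphon_degree W x)
      + (LINT y | unit_measure. hellinger (W (x, y)) (graphon_degree W x)))"
    using unit_pair.integral_fst'[OF H] unit_pair.integrable_fst'[OF H] entropy_degree_integrable by simp
  also have "\<dots> \<le> (LINT x | unit_measure. LINT y | unit_measure. entropy_fun (W (x, y)))"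
    using unit_pair.integrable_fst'[OF H] unit_pair.integrable_fst'[OF E] entropy_degree_integrable
      entropy_section_ge
    by (intro integral_mono) auto
  also have "\<dots> = graphon_entropy W"
    unfolding graphon_entropy_def by (rule unit_pair.integral_fst'[OF E])
  finally show ?thesis .
qed

end

section \<open>Maximizers among graphons\<close>

lemma constant_graphon_value:
  fixes \<mu> :: "real ^ 'k::finite"
  assumes "\<mu> \<in> color_simplex"
  shows "star_functional S \<beta> (\<lambda>_. \<mu>) - 1 / 2 * graphon_entropy (\<lambda>_. \<mu>)
    = star_poly S \<beta> \<mu> - 1 / 2 * entropy_fun \<mu>"
proof -
  have "graphon_degree (\<lambda>_. \<mu>) = (\<lambda>_. \<mu>)"
    using unit.prob_space by (simp add: graphon_degree_def fun_eq_iff)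
  then show ?thesis
    using unit.prob_space unit_pair.prob_space star_functional_eq[OF constant_in_prob_graphons[OF assms]]
    by (simp add: graphon_entropy_def)
qed

text \<open>With \<phi> = P - I/2, its supremum M, the degrees d of \<open>W\<close>, the value V at
  \<open>W\<close> and the integrated defect G, the chain M \<le> V \<le> (integral of \<phi>(d)) -
  G/2 \<le> M collapses. So G = 0 and \<phi>(d) = M almost everywhere.\<close>

lemma graphon_maximizer_constant:
  fixes W :: "real \<times> real \<Rightarrow> real ^ 'k::finite"
  assumes max: "is_arg_max (\<lambda>W. star_functional S \<beta> W - 1 / 2 * graphon_entropy W)
    (\<lambda>W. W \<in> prob_graphons) W"
  shows "\<exists>\<mu>. is_arg_max (\<lambda>\<mu>. star_poly S \<beta> \<mu> - 1 / 2 * entropy_fun \<mu>) (\<lambda>\<mu>. \<mu> \<in> color_simplex) \<mu>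
    \<and> (AE p in unit_measure \<Otimes>\<^sub>M unit_measure. W p = \<mu>)"
proof -
  define \<phi> :: "real ^ 'k \<Rightarrow> real" where "\<phi> = (\<lambda>\<mu>. star_poly S \<beta> \<mu> - 1 / 2 * entropy_fun \<mu>)"
  define M where "M = (SUP \<mu>\<in>color_simplex. \<phi> \<mu>)"
  have le_M: "\<phi> \<mu> \<le> M" if "\<mu> \<in> color_simplex" for \<mu>
    unfolding M_def \<phi>_def using bdd_above_free_energy that by (intro cSUP_upper)
  have W: "W \<in> prob_graphons" using max by (simp add: is_arg_max_def)
  let ?d = "graphon_degree W"
  let ?V = "star_functional S \<beta> W - 1 / 2 * graphon_entropy W"
  note d = graphon_degree_in_simplex[OF W]
  have int_\<phi>: "integrable unit_measure (\<lambda>x. \<phi> (?d x))"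
    unfolding \<phi>_def using star_poly_degree_integrable[OF W] entropy_degree_integrable[OF W] by auto
  \<comment> \<open>Constant graphons are competitors, and their value is \<phi> \<mu>.\<close>
  have "\<phi> \<mu> \<le> ?V" if "\<mu> \<in> color_simplex" for \<mu>
    using max constant_in_prob_graphons[OF that] constant_graphon_value[OF that, of S \<beta>]
    by (force simp: is_arg_max_def \<phi>_def not_less)
  then have "M \<le> ?V" unfolding M_def using color_simplex_nonempty by (intro cSUP_least)
  define G where "G = (LINT p | (unit_measure \<Otimes>\<^sub>M unit_measure). hellinger (W p) (?d (fst p)))"
  have "?V \<le> (LINT x | unit_measure. \<phi> (?d x)) - 1 / 2 * G"
    using graphon_entropy_ge[OF W] star_functional_eq[OF W, of S \<beta>]
      star_poly_degree_integrable[OF W, of S \<beta>] entropy_degree_integrable[OF W]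
    by (simp add: \<phi>_def G_def)
  moreover have "(LINT x | unit_measure. M - \<phi> (?d x)) = M - (LINT x | unit_measure. \<phi> (?d x))"
    using int_\<phi> unit.prob_space by simp
  moreover have "0 \<le> (LINT x | unit_measure. M - \<phi> (?d x))"
    using le_M d by (intro integral_nonneg_AE AE_I2) auto
  moreover have "0 \<le> G" unfolding G_def by (intro integral_nonneg_AE AE_I2 hellinger_nonneg)
  ultimately have "G = 0" and zero: "(LINT x | unit_measure. M - \<phi> (?d x)) = 0"
    using \<open>M \<le> ?V\<close> by linarith+
  have opt: "AE x in unit_measure. \<phi> (?d x) = M"
  proof -
    have "AE x in unit_measure. M - \<phi> (?d x) = 0"
      using zero int_\<phi> le_M d
      by (subst (asm) integral_nonneg_eq_0_iff_AE) (auto intro!: AE_I2)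
    then show ?thesis by eventually_elim simp
  qed
  have row: "AE p in unit_measure \<Otimes>\<^sub>M unit_measure. W p = ?d (fst p)"
  proof -
    have "AE p in unit_measure \<Otimes>\<^sub>M unit_measure. hellinger (W p) (?d (fst p)) = 0"
      using \<open>G = 0\<close> integral_nonneg_eq_0_iff_AE[OF hellinger_graphon_integrable[OF W]]
        hellinger_nonneg unfolding G_def by auto
    then show ?thesis by (simp add: hellinger_eq_0_iff)
  qed
  \<comment> \<open>Exchanging the coordinates preserves the product measure, so also W(y,x) = d(y)
    almost everywhere. With W(x,y) = d(x) and symmetry this gives d(x) = d(y) for almost every
    pair.\<close>
  have "AE p in distr (unit_measure \<Otimes>\<^sub>M unit_measure) (unit_measure \<Otimes>\<^sub>M unit_measure) (\<lambda>(x, y). (y, x)).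
      W p = ?d (fst p)"
    using row by (subst unit_pair.distr_pair_swap[symmetric])
  then have "AE p in unit_measure \<Otimes>\<^sub>M unit_measure. W (case p of (x, y) \<Rightarrow> (y, x)) = ?d (fst (case p of (x, y) \<Rightarrow> (y, x)))"
    by (rule AE_distrD[OF measurable_pair_swap'])
  with row AE_space have "AE p in unit_measure \<Otimes>\<^sub>M unit_measure. ?d (snd p) = ?d (fst p)"
  proof eventually_elim
    case (elim p)
    then show ?case using graphon_symmetric[OF W, of "fst p" "snd p"]
      by (cases p) (auto simp: space_pair_measure)
  qed
  then have "AE x in unit_measure. AE y in unit_measure. ?d y = ?d x"
    using unit_pair.AE_pair by fastforce
  with opt AE_space have "AE x in unit_measure. x \<in> {0..1} \<and> \<phi> (?d x) = M \<and> (AE y in unit_measure. ?d y = ?d x)"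
    by eventually_elim simp
  \<comment> \<open>A property that holds almost everywhere in a probability space holds at some
    point. The degree at this point is the constant sought.\<close>
  then have "\<exists>x. x \<in> {0..1} \<and> \<phi> (?d x) = M \<and> (AE y in unit_measure. ?d y = ?d x)"
    using unit.AE_contr[OF _ AE_I2] by blast
  then obtain x where x: "x \<in> {0..1}" "\<phi> (?d x) = M" "AE y in unit_measure. ?d y = ?d x"
    by blast
  have "AE p in unit_measure \<Otimes>\<^sub>M unit_measure. ?d (fst p) = ?d x"
  proof (rule unit_pair.AE_pair_measure)
    show "{p \<in> space (unit_measure \<Otimes>\<^sub>M unit_measure). ?d (fst p) = ?d x}
        \<in> sets (unit_measure \<Otimes>\<^sub>M unit_measure)"
      using measurable_sets[OF measurable_compose[OF measurable_fst graphon_degree_measurable[OF W]],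
          of "{?d x}" unit_measure]
      by (simp add: vimage_def Int_def conj_commute)
    show "AE y in unit_measure. AE z in unit_measure. ?d (fst (y, z)) = ?d x"
      using x(3) by eventually_elim simp
  qed
  with row have "AE p in unit_measure \<Otimes>\<^sub>M unit_measure. W p = ?d x"
    by eventually_elim simp
  moreover have "is_arg_max \<phi> (\<lambda>\<mu>. \<mu> \<in> color_simplex) (?d x)"
    using x le_M d[OF x(1)] by (auto simp: is_arg_max_def not_less)
  ultimately show ?thesis unfolding \<phi>_def by blast
qed

section \<open>Empirical graphons as block averages\<close>

text \<open>The first block is closed on the left because \<open>block_index\<close> sends 0 to 1;
  every block therefore has length 1/n and the blocks cover all of [0,1].\<close>

lemma block_index_vimage:
  assumes "u \<in> {1..n}"
  shows "{x \<in> {0..1}. block_index n x = u}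
    = (if u = 1 then {0..1 / real n} else {(real u - 1) / real n <.. real u / real n})"
proof -
  have n: "real n > 0" using assms by simp
  have un: "real u \<le> real n" "real u \<ge> 1" using assms by auto
  have eq_iff: "block_index n x = u \<longleftrightarrow> (real u - 1 < real n * x \<or> u = 1) \<and> real n * x \<le> real u"
    if "x \<in> {0..1}" for x
    unfolding block_index_def using assms that by (simp add: max_def) linarith
  have range: "x \<in> {0..1}" if "real u - 1 < real n * x \<or> u = 1 \<and> 0 \<le> x" "real n * x \<le> real u" for x
  proof -
    have "0 \<le> x"
      using that(1) un zero_less_mult_pos[OF _ n, of x] by force
    moreover have "real n * x \<le> real n * 1" using that(2) un by linarith
    then have "x \<le> 1" using n by (simp only: mult_le_cancel_left_pos)
    ultimately show ?thesis by simp
  qed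
  have scale: "x \<le> real u / real n \<longleftrightarrow> real n * x \<le> real u"
    "(real u - 1) / real n < x \<longleftrightarrow> real u - 1 < real n * x" for x
    using n by (simp_all add: pos_le_divide_eq pos_divide_less_eq mult.commute)
  show ?thesis
  proof (rule set_eqI)
    fix x
    show "x \<in> {x \<in> {0..1}. block_index n x = u} \<longleftrightarrow>
        x \<in> (if u = 1 then {0..1 / real n} else {(real u - 1) / real n <.. real u / real n})"
    proof (cases "x \<in> {0..1}")
      case True
      then show ?thesis
        using eq_iff[OF True] scale[of x] by (cases "u = 1") simp_all
    next
      case False
      then show ?thesis
        using scale[of x] range[of x] by (cases "u = 1") auto
    qed
  qed
qed

lemma block_index_in_range:
  assumes "n \<ge> 1" "x \<in> {0..1}"
  shows "block_index n x \<in> {1..n}"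
proof -
  have "real n * x \<le> real n" using assms by (simp add: mult_left_le)
  then show ?thesis
    using assms unfolding block_index_def by (simp add: ceiling_le_iff nat_le_iff)
qed

lemma integral_block_index:
  assumes n: "n \<ge> 1"
  shows "(LINT x | unit_measure. g (block_index n x)) = (\<Sum>u\<in>{1..n}. g u) / real n"
proof -
  define A where "A = (\<lambda>u. {x \<in> {0..1}. block_index n x = u})"
  have A_Int: "A u \<inter> {0..1} = A u" for u by (auto simp: A_def)
  have A: "A u \<in> sets unit_measure" "measure unit_measure (A u) = 1 / real n" if u: "u \<in> {1..n}" for u
  proof -
    have borel: "A u \<in> sets borel" unfolding A_def block_index_vimage[OF u] by simp
    then show "A u \<in> sets unit_measure" by (auto simp: sets_restrict_space_iff A_def)
    have "measure unit_measure (A u) = measure lborel (A u)"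
      by (intro measure_restrict_space) (auto simp: A_def)
    also have "\<dots> = 1 / real n"
      unfolding A_def block_index_vimage[OF u] using u by (simp add: diff_divide_distrib)
    finally show "measure unit_measure (A u) = 1 / real n" .
  qed
  have "(LINT x | unit_measure. g (block_index n x))
      = (LINT x | unit_measure. (\<Sum>u\<in>{1..n}. g u * indicator (A u) x))"
  proof (rule Bochner_Integration.integral_cong[OF refl])
    fix x assume "x \<in> space unit_measure"
    then have x: "x \<in> {0..1}" by simp
    have "block_index n x \<in> {1..n}" by (rule block_index_in_range[OF n x])
    then have "g (block_index n x) = (\<Sum>u\<in>{1..n}. if u = block_index n x then g u else 0)" by simp
    also have "\<dots> = (\<Sum>u\<in>{1..n}. g u * indicator (A u) x)"
      using x by (intro sum.cong) (auto simp: A_def indicator_def)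
    finally show "g (block_index n x) = (\<Sum>u\<in>{1..n}. g u * indicator (A u) x)" .
  qed
  also have "\<dots> = (\<Sum>u\<in>{1..n}. g u * (1 / real n))"
    using A by (subst Bochner_Integration.integral_sum)
      (auto simp: unit.emeasure_eq_measure A_Int intro!: sum.cong)
  finally show ?thesis by (simp add: sum_divide_distrib)
qed

lemma graphon_degree_empirical:
  fixes X :: "nat set \<Rightarrow> 'k::finite"
  assumes n: "n \<ge> 1" and u: "block_index n x \<in> {1..n}"
  shows "graphon_degree (empirical_graphon n X) x = block_freq n X (block_index n x)"
proof -
  let ?u = "block_index n x"
  have "graphon_degree (empirical_graphon n X) x $ a = block_freq n X ?u $ a" for a
  proof -
    let ?g = "\<lambda>v. if ?u = v then 1 / real CARD('k) else if X {?u, v} = a then 1 else 0"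
    have "graphon_degree (empirical_graphon n X) x $ a = (LINT y | unit_measure. ?g (block_index n y))"
      by (simp add: graphon_degree_def empirical_graphon_def Let_def)
    also have "\<dots> = (\<Sum>v\<in>{1..n}. ?g v) / real n"
      by (rule integral_block_index[OF n])
    \<comment> \<open>The diagonal block is the source of the 1/k in
      \<open>block_freq\<close>.\<close>
    also have "(\<Sum>v\<in>{1..n}. ?g v) = 1 / real CARD('k) + (\<Sum>v\<in>{1..n} - {?u}. ?g v)"
      using u by (subst sum.remove[of _ ?u]) auto
    also have "(\<Sum>v\<in>{1..n} - {?u}. ?g v) = (\<Sum>v\<in>{1..n} - {?u}. if X {?u, v} = a then 1 else 0)"
      by (intro sum.cong) auto
    also have "\<dots> = real (color_degree n X ?u a)"
      by (simp add: color_degree_def sum.If_cases Int_def)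
    finally show ?thesis by (simp add: block_freq_def add.commute)
  qed
  then show ?thesis by (simp add: vec_eq_iff)
qed

lemma star_functional_empirical:
  fixes X :: "nat set \<Rightarrow> 'k::finite"
  assumes n: "n \<ge> 1"
  shows "star_functional S \<beta> (empirical_graphon n X)
    = (\<Sum>u\<in>{1..n}. star_poly S \<beta> (block_freq n X u)) / real n"
proof -
  have "star_functional S \<beta> (empirical_graphon n X)
      = (LINT x | unit_measure. star_poly S \<beta> (block_freq n X (block_index n x)))"
    unfolding star_functional_eq[OF empirical_graphon_in_prob_graphons]
  proof (rule Bochner_Integration.integral_cong[OF refl])
    fix x assume "x \<in> space unit_measure"
    then have x: "x \<in> {0..1}" by simp
    have "block_index n x \<in> {1..n}" by (rule block_index_in_range[OF n x])
    then show "star_poly S \<beta> (graphon_degree (empirical_graphon n X) x)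
        = star_poly S \<beta> (block_freq n X (block_index n x))"
      by (simp add: graphon_degree_empirical[OF n])
  qed
  also have "\<dots> = (\<Sum>u\<in>{1..n}. star_poly S \<beta> (block_freq n X u)) / real n"
    by (rule integral_block_index[OF n])
  finally show ?thesis .
qed

theorem theorem3p5:
  fixes S :: "(nat ^ 'k::finite) set" and \<beta> :: "nat ^ 'k \<Rightarrow> real"
  assumes "CARD('k) \<ge> 2" and "finite S"
  shows "log_partition S \<beta> \<longlonglongrightarrow>
           (SUP \<mu>\<in>color_simplex. star_poly S \<beta> \<mu> - 1 / 2 * entropy_fun \<mu>)
       \<and> (\<forall>W :: real \<times> real \<Rightarrow> real ^ 'k.
             is_arg_max (\<lambda>W. star_functional S \<beta> W - 1 / 2 * graphon_entropy W)
               (\<lambda>W. W \<in> prob_graphons) W \<longrightarrow>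
             (\<exists>\<mu>. is_arg_max (\<lambda>\<mu>. star_poly S \<beta> \<mu> - 1 / 2 * entropy_fun \<mu>)
                    (\<lambda>\<mu>. \<mu> \<in> color_simplex) \<mu>
                \<and> (AE p in unit_measure \<Otimes>\<^sub>M unit_measure. W p = \<mu>)))"
proof (intro conjI allI impI)
  \<comment> \<open>T of the empirical graphon is the mean of P over the n blocks, so n^2 T is n
    times a sum over vertices. This holds from n = 1 on, which suffices for the limit.\<close>
  have eq: "log_partition S \<beta> n = 1 / (real n)\<^sup>2 * ln (\<Sum>X\<in>colorings n.
      exp (real n * (\<Sum>u\<in>{1..n}. star_poly S \<beta> (block_freq n X u))))" if "n \<ge> 1" for n
    using that unfolding log_partition_def star_functional_empirical[OF that]
    by (simp add: power2_eq_square)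
  show "log_partition S \<beta> \<longlonglongrightarrow>
      (SUP \<mu>\<in>color_simplex. star_poly S \<beta> \<mu> - 1 / 2 * entropy_fun \<mu>)"
    using eventually_ge_at_top[of 1]
    by (rule Lim_transform_eventually[OF block_partition_limit eventually_mono]) (rule eq[symmetric])
next
  fix W :: "real \<times> real \<Rightarrow> real ^ 'k"
  assume "is_arg_max (\<lambda>W. star_functional S \<beta> W - 1 / 2 * graphon_entropy W)
    (\<lambda>W. W \<in> prob_graphons) W"
  then show "\<exists>\<mu>. is_arg_max (\<lambda>\<mu>. star_poly S \<beta> \<mu> - 1 / 2 * entropy_fun \<mu>)
        (\<lambda>\<mu>. \<mu> \<in> color_simplex) \<mu>
      \<and> (AE p in unit_measure \<Otimes>\<^sub>M unit_measure. W p = \<mu>)"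
    by (rule graphon_maximizer_constant)
qed

end
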